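(* Let $R\subseteq\{e,c,o\}$. The provability problem for $\mathbf{NACILL}^0_R$ is undecidable: there is no algorithm deciding, for an arbitrary sequent $s$, whether $s$ is provable in $\mathbf{NACILL}^0_R$.
   Context: Formulas: terms over a countably infinite set of variables in $\{\wedge,\vee,\cdot,\backslash,/,!,1,0\}$. Structures: elements of the free unital groupoid $(Fm^\circ,\circ,\varepsilon)$ generated by formulas ($\circ$ non-associative, $\varepsilon$ empty structure and unit). $k$ ranges over structures in the free unital groupoid generated by formulas $!a$ (including $\varepsilon$). A context $u$ is a structure with exactly one hole; $u(x)$ fills it with $x$. A sequent is $x\Rightarrow\delta$, $x$ a structure, $\delta$ a formula or the empty stoup $\epsilon$. $\mathbf{NACILL}^0$: initial sequents $a\Rightarrow a$, $\varepsilon\Rightarrow 1$, $0\Rightarrow\epsilon$; rules (premises / conclusion): (cut) $x\Rightarrow a$, $u(a)\Rightarrow\delta$ / $u(x)\Rightarrow\delta$; $(1\Rightarrow)$ $u(\varepsilon)\Rightarrow\delta$ / $u(1)\Rightarrow\delta$; $(\Rightarrow 0)$ $x\Rightarrow\epsilon$ / $x\Rightarrow 0$; $(\backslash\Rightarrow)$ $x\Rightarrow a$, $u(b)\Rightarrow\delta$ / $u(x\circ(a\backslash b))\Rightarrow\delta$; $(\Rightarrow\backslash)$ $a\circ x\Rightarrow b$ / $x\Rightarrow a\backslash b$; $(/\Rightarrow)$ $x\Rightarrow a$, $u(b)\Rightarrow\delta$ / $u((b/a)\circ x)\Rightarrow\delta$; $(\Rightarrow/)$ $x\circ a\Rightarrow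 b$ / $x\Rightarrow b/a$; $(\cdot\Rightarrow)$ $u(a\circ b)\Rightarrow\delta$ / $u(a\cdot b)\Rightarrow\delta$; $(\Rightarrow\cdot)$ $x\Rightarrow a$, $y\Rightarrow b$ / $x\circ y\Rightarrow a\cdot b$; $(\wedge\Rightarrow)$ $u(a_i)\Rightarrow\delta$ / $u(a_1\wedge a_2)\Rightarrow\delta$; $(\Rightarrow\wedge)$ $x\Rightarrow a$, $x\Rightarrow b$ / $x\Rightarrow a\wedge b$; $(\vee\Rightarrow)$ $u(a)\Rightarrow\delta$, $u(b)\Rightarrow\delta$ / $u(a\vee b)\Rightarrow\delta$; $(\Rightarrow\vee)$ $x\Rightarrow a_i$ / $x\Rightarrow a_1\vee a_2$; $(!\Rightarrow)$ $u(a)\Rightarrow\delta$ / $u(!a)\Rightarrow\delta$; $(\Rightarrow!)$ $k\Rightarrow a$ / $k\Rightarrow !a$; $(kw)$ $u(\varepsilon)\Rightarrow\delta$ / $u(k)\Rightarrow\delta$; $(kc)$ $u(k\circ k)\Rightarrow\delta$ / $u(k)\Rightarrow\delta$; two-directional: $(ke)$ $u(k\circ y)\Rightarrow\delta\leftrightarrow u(y\circ k)\Rightarrow\delta$; $(ka1)$ $u((k\circ y)\circ z)\Rightarrow\delta\leftrightarrow u(k\circ(y\circ z))\Rightarrow\delta$; $(ka2)$ $u((x\circ y)\circ k)\Rightarrow\delta\leftrightarrow u(x\circ(y\circ k))\Rightarrow\delta$. Structural rules: $(e)$ $u(x\circ y)\Rightarrow\delta$ / $u(y\circ x)\Rightarrow\delta$;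 $(c)$ $u(x\circ x)\Rightarrow\delta$ / $u(x)\Rightarrow\delta$; $(o)$ $x\Rightarrow\epsilon$ / $x\Rightarrow a$. $\mathbf{NACILL}^0_R$ is $\mathbf{NACILL}^0$ plus the rules in $R$; a sequent is provable if it has a derivation whose leaves are initial sequents. *)

theory Defs
  imports "HOL-Library.Nat_Bijection"
begin

datatype fm = FVar nat | Meet fm fm | Join fm fm | Prod fm fm
  | Ldiv fm fm   (* Ldiv a b  =  a \ b *)
  | Rdiv fm fm   (* Rdiv b a  =  b / a *)
  | Bang fm | FOne | FZero

(* raw structure trees; the free unital groupoid is represented by the
   well-formed (epsilon-free inside compositions) trees, see wf_st *)
datatype st = SF fm | SC st st | SE

fun wf_st :: "st \<Rightarrow> bool" where
  "wf_st SE = True"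
| "wf_st (SF a) = True"
| "wf_st (SC x y) = (x \<noteq> SE \<and> y \<noteq> SE \<and> wf_st x \<and> wf_st y)"

definition comp :: "st \<Rightarrow> st \<Rightarrow> st" where
  "comp x y = (if x = SE then y else if y = SE then x else SC x y)"

datatype ctx = Hole | CL ctx st | CR st ctx

fun wf_ctx :: "ctx \<Rightarrow> bool" where
  "wf_ctx Hole = True"
| "wf_ctx (CL u y) = (wf_ctx u \<and> wf_st y)"
| "wf_ctx (CR y u) = (wf_st y \<and> wf_ctx u)"

fun fill :: "ctx \<Rightarrow> st \<Rightarrow> st" where
  "fill Hole x = x"
| "fill (CL u y) x = comp (fill u x) y"
| "fill (CR y u) x = comp y (fill u x)"

fun bang_only :: "st \<Rightarrow> bool" where
  "bang_only SE = True"
| "bang_only (SF a) = (\<exists>b. a = Bang b)"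
| "bang_only (SC x y) = (bang_only x \<and> bang_only y)"

definition is_k :: "st \<Rightarrow> bool" where
  "is_k k = (wf_st k \<and> bang_only k)"

datatype srule = RuleE | RuleC | RuleO

(* stoup: None = empty stoup, Some a = formula a *)
inductive prov :: "srule set \<Rightarrow> st \<Rightarrow> fm option \<Rightarrow> bool" for R where
  ax: "prov R (SF a) (Some a)"
| oneR: "prov R SE (Some FOne)"
| zeroL: "prov R (SF FZero) None"
| cut: "\<lbrakk>wf_st x; wf_ctx u; prov R x (Some a); prov R (fill u (SF a)) d\<rbrakk>
        \<Longrightarrow> prov R (fill u x) d"
| oneL: "\<lbrakk>wf_ctx u; prov R (fill u SE) d\<rbrakk> \<Longrightarrow> prov R (fill u (SF FOne)) d"
| zeroR: "\<lbrakk>wf_st x; prov R x None\<rbrakk> \<Longrightarrow> prov R x (Some FZero)"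
| ldivL: "\<lbrakk>wf_st x; wf_ctx u; prov R x (Some a); prov R (fill u (SF b)) d\<rbrakk>
        \<Longrightarrow> prov R (fill u (comp x (SF (Ldiv a b)))) d"
| ldivR: "\<lbrakk>wf_st x; prov R (comp (SF a) x) (Some b)\<rbrakk> \<Longrightarrow> prov R x (Some (Ldiv a b))"
| rdivL: "\<lbrakk>wf_st x; wf_ctx u; prov R x (Some a); prov R (fill u (SF b)) d\<rbrakk>
        \<Longrightarrow> prov R (fill u (comp (SF (Rdiv b a)) x)) d"
| rdivR: "\<lbrakk>wf_st x; prov R (comp x (SF a)) (Some b)\<rbrakk> \<Longrightarrow> prov R x (Some (Rdiv b a))"
| prodL: "\<lbrakk>wf_ctx u; prov R (fill u (SC (SF a) (SF b))) d\<rbrakk> \<Longrightarrow> prov R (fill u (SF (Prod a b))) d"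
| prodR: "\<lbrakk>wf_st x; wf_st y; prov R x (Some a); prov R y (Some b)\<rbrakk>
        \<Longrightarrow> prov R (comp x y) (Some (Prod a b))"
| meetL1: "\<lbrakk>wf_ctx u; prov R (fill u (SF a)) d\<rbrakk> \<Longrightarrow> prov R (fill u (SF (Meet a b))) d"
| meetL2: "\<lbrakk>wf_ctx u; prov R (fill u (SF b)) d\<rbrakk> \<Longrightarrow> prov R (fill u (SF (Meet a b))) d"
| meetR: "\<lbrakk>wf_st x; prov R x (Some a); prov R x (Some b)\<rbrakk> \<Longrightarrow> prov R x (Some (Meet a b))"
| joinL: "\<lbrakk>wf_ctx u; prov R (fill u (SF a)) d; prov R (fill u (SF b)) d\<rbrakk>
        \<Longrightarrow> prov R (fill u (SF (Join a b))) d"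
| joinR1: "\<lbrakk>wf_st x; prov R x (Some a)\<rbrakk> \<Longrightarrow> prov R x (Some (Join a b))"
| joinR2: "\<lbrakk>wf_st x; prov R x (Some b)\<rbrakk> \<Longrightarrow> prov R x (Some (Join a b))"
| bangL: "\<lbrakk>wf_ctx u; prov R (fill u (SF a)) d\<rbrakk> \<Longrightarrow> prov R (fill u (SF (Bang a))) d"
| bangR: "\<lbrakk>is_k k; prov R k (Some a)\<rbrakk> \<Longrightarrow> prov R k (Some (Bang a))"
| kw: "\<lbrakk>is_k k; wf_ctx u; prov R (fill u SE) d\<rbrakk> \<Longrightarrow> prov R (fill u k) d"
| kc: "\<lbrakk>is_k k; wf_ctx u; prov R (fill u (comp k k)) d\<rbrakk> \<Longrightarrow> prov R (fill u k) d"
| ke1: "\<lbrakk>is_k k; wf_st y; wf_ctx u; prov R (fill u (comp k y)) d\<rbrakk> \<Longrightarrow> prov R (fill u (comp y k)) d"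
| ke2: "\<lbrakk>is_k k; wf_st y; wf_ctx u; prov R (fill u (comp y k)) d\<rbrakk> \<Longrightarrow> prov R (fill u (comp k y)) d"
| ka1a: "\<lbrakk>is_k k; wf_st y; wf_st z; wf_ctx u; prov R (fill u (comp (comp k y) z)) d\<rbrakk>
        \<Longrightarrow> prov R (fill u (comp k (comp y z))) d"
| ka1b: "\<lbrakk>is_k k; wf_st y; wf_st z; wf_ctx u; prov R (fill u (comp k (comp y z))) d\<rbrakk>
        \<Longrightarrow> prov R (fill u (comp (comp k y) z)) d"
| ka2a: "\<lbrakk>is_k k; wf_st x; wf_st y; wf_ctx u; prov R (fill u (comp (comp x y) k)) d\<rbrakk>
        \<Longrightarrow> prov R (fill u (comp x (comp y k))) d"
| ka2b: "\<lbrakk>is_k k; wf_st x; wf_st y; wf_ctx u; prov R (fill u (comp x (comp y k))) d\<rbrakk>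
        \<Longrightarrow> prov R (fill u (comp (comp x y) k)) d"
| ruleE: "\<lbrakk>RuleE \<in> R; wf_st x; wf_st y; wf_ctx u; prov R (fill u (comp x y)) d\<rbrakk>
        \<Longrightarrow> prov R (fill u (comp y x)) d"
| ruleC: "\<lbrakk>RuleC \<in> R; wf_st x; wf_ctx u; prov R (fill u (comp x x)) d\<rbrakk>
        \<Longrightarrow> prov R (fill u x) d"
| ruleO: "\<lbrakk>RuleO \<in> R; wf_st x; prov R x None\<rbrakk> \<Longrightarrow> prov R x (Some a)"

fun enc_fm :: "fm \<Rightarrow> nat" where
  "enc_fm (FVar n) = prod_encode (0, n)"
| "enc_fm (Meet a b) = prod_encode (1, prod_encode (enc_fm a, enc_fm b))"
| "enc_fm (Join a b) = prod_encode (2, prod_encode (enc_fm a, enc_fm b))"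
| "enc_fm (Prod a b) = prod_encode (3, prod_encode (enc_fm a, enc_fm b))"
| "enc_fm (Ldiv a b) = prod_encode (4, prod_encode (enc_fm a, enc_fm b))"
| "enc_fm (Rdiv a b) = prod_encode (5, prod_encode (enc_fm a, enc_fm b))"
| "enc_fm (Bang a) = prod_encode (6, enc_fm a)"
| "enc_fm FOne = prod_encode (7, 0)"
| "enc_fm FZero = prod_encode (8, 0)"

fun enc_st :: "st \<Rightarrow> nat" where
  "enc_st SE = prod_encode (0, 0)"
| "enc_st (SF a) = prod_encode (1, enc_fm a)"
| "enc_st (SC x y) = prod_encode (2, prod_encode (enc_st x, enc_st y))"

fun enc_stoup :: "fm option \<Rightarrow> nat" where
  "enc_stoup None = 0"
| "enc_stoup (Some a) = Suc (enc_fm a)"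

definition enc_seq :: "st \<Rightarrow> fm option \<Rightarrow> nat" where
  "enc_seq x d = prod_encode (enc_st x, enc_stoup d)"

fun PR :: "(nat list \<Rightarrow> nat) \<Rightarrow> (nat list \<Rightarrow> nat) \<Rightarrow> nat list \<Rightarrow> nat" where
  "PR g h [] = 0"
| "PR g h (0 # xs) = g xs"
| "PR g h (Suc y # xs) = h (y # PR g h (y # xs) # xs)"

(* recfn n f : f is a total recursive function of arity n (meaningful on lists of length n) *)
inductive recfn :: "nat \<Rightarrow> (nat list \<Rightarrow> nat) \<Rightarrow> bool" where
  zero: "recfn n (\<lambda>_. 0)"
| succ: "recfn 1 (\<lambda>xs. Suc (hd xs))"
| proj: "i < n \<Longrightarrow> recfn n (\<lambda>xs. xs ! i)"
| compose: "\<lbrakk>recfn m f; length gs = m; \<forall>g\<in>set gs. recfn n g\<rbrakk>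
            \<Longrightarrow> recfn n (\<lambda>xs. f (map (\<lambda>g. g xs) gs))"
| prim_rec: "\<lbrakk>recfn n g; recfn (n + 2) h\<rbrakk> \<Longrightarrow> recfn (Suc n) (PR g h)"
| minimize: "\<lbrakk>recfn (Suc n) f; \<forall>xs. length xs = n \<longrightarrow> (\<exists>y. f (y # xs) = 0)\<rbrakk>
            \<Longrightarrow> recfn n (\<lambda>xs. LEAST y. f (y # xs) = 0)"

end

theory Submission
  imports Defs "HOL-Library.Countable"
begin

text \<open>
  Every total recursive function is verified by an alternating register machine with instructions for
  branching universally, overwriting a register by an arbitrary value, decrementing and testing for zero.
  Runs of such a machine are simulated by derivations in the weakest calculus: the universal branching is
  the rule for joins on the left, and the finitely many rewrite rules are implications kept in one banged
  formula, which can be duplicated and moved anywhere. Conversely a phase model on a commutative groupoid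
  in which \<open>x \<cdot> x\<close> is absorbing for every \<open>x\<close> but the unit, with \<open>!a\<close> interpreted by the unit or the bottom,
  validates the strongest calculus and shows that a derivable configuration is accepted.
  No universal machine is needed: if \<open>f\<close> decided provability, then the function sending \<open>e\<close> to the value
  of \<open>f\<close> at ``program \<open>e\<close> on input \<open>e\<close>'' would be recursive, and the program testing it for zero,
  run on its own code, would be accepted iff it is not.
\<close>

section \<open>Alternating register machines\<close>

text \<open>The combs are unbounded and composition is not associative, so a rule matching a bounded
  subtree cannot relate the state to a register. Each such dependence becomes an extra branch of a
  join, where one fact is checked and everything else is thrown away. The obstacle from contraction
  is met by the same bracketing: tallies join a comb one at a time, so two tallies alone never form
  a subtree of a configuration, and their product may be declared absorbing. For the diagonal
  argument the input register is the outermost component. The rules, the state and the other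
  registers then form one fixed substructure, whose code serves as the index of the program.\<close>

datatype instr = Fork nat nat nat | Havoc nat nat | Dec nat nat nat | Zero nat nat

fun src :: "instr \<Rightarrow> nat" where
  "src (Fork q _ _) = q"
| "src (Havoc q _) = q"
| "src (Dec q _ _) = q"
| "src (Zero q _) = q"

text \<open>Instructions with the same source are alternatives; only \<open>Fork\<close> is
  universal. There is no conditional jump: \<open>Zero\<close> ends its branch in
  acceptance.\<close>

inductive acc :: "instr set \<Rightarrow> nat \<Rightarrow> (nat \<Rightarrow> nat) \<Rightarrow> bool" for P where
  fork: "\<lbrakk>Fork q q1 q2 \<in> P; acc P q1 v; acc P q2 v\<rbrakk> \<Longrightarrow> acc P q v"
| havoc: "\<lbrakk>Havoc q i \<in> P; acc P q (v(i := n))\<rbrakk> \<Longrightarrow> acc P q v"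
| dec: "\<lbrakk>Dec q i q' \<in> P; v i = Suc n; acc P q' (v(i := n))\<rbrakk> \<Longrightarrow> acc P q v"
| zero: "\<lbrakk>Zero q i \<in> P; v i = 0\<rbrakk> \<Longrightarrow> acc P q v"

type_synonym rel = "(nat \<Rightarrow> nat) \<Rightarrow> bool"

text \<open>The quantification over all programs \<open>Q\<close> that contain the given instructions and no others in their
  state range lets blocks with disjoint ranges be put together; \<open>t\<close> is the state entered when the block is left.\<close>

definition implementable :: "(rel \<Rightarrow> rel) \<Rightarrow> bool" where
  "implementable \<Phi> \<longleftrightarrow> (\<forall>s t. \<exists>s' P. s < s' \<and> finite P \<and> src ` P \<subseteq> {s..<s'} \<and>
     (\<forall>Q. {I \<in> Q. src I \<in> {s..<s'}} = P \<longrightarrow> (\<forall>v. acc Q s v = \<Phi> (acc Q t) v)))"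

lemma implementableE:
  assumes "implementable \<Phi>"
  obtains s' P where "s < s'" "finite P" "src ` P \<subseteq> {s..<s'}"
    "\<And>Q v. {I \<in> Q. src I \<in> {s..<s'}} = P \<Longrightarrow> acc Q s v = \<Phi> (acc Q t) v"
  using assms unfolding implementable_def by metis

lemma implementable_atomI:
  assumes "\<And>s t. \<exists>P. finite P \<and> (\<forall>I\<in>P. src I = s) \<and>
    (\<forall>Q. {I \<in> Q. src I = s} = P \<longrightarrow> (\<forall>v. acc Q s v = \<Phi> (acc Q t) v))"
  shows "implementable \<Phi>"
  unfolding implementable_def
proof (intro allI)
  fix s t
  obtain P where P: "finite P" "\<forall>I\<in>P. src I = s"
    "\<forall>Q. {I \<in> Q. src I = s} = P \<longrightarrow> (\<forall>v. acc Q s v = \<Phi> (acc Q t) v)"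
    using assms by meson
  have "(x \<in> {s..<Suc s}) = (x = s)" for x by auto
  then show "\<exists>s' P. s < s' \<and> finite P \<and> src ` P \<subseteq> {s..<s'} \<and>
     (\<forall>Q. {I \<in> Q. src I \<in> {s..<s'}} = P \<longrightarrow> (\<forall>v. acc Q s v = \<Phi> (acc Q t) v))"
    using P by (intro exI[of _ "Suc s"] exI[of _ P]) (simp add: image_subset_iff)
qed

text \<open>A successful test ends the branch, so the exit predicate \<open>X\<close> does not
  occur; a test with a continuation is obtained by conjunction with another block.\<close>

lemma implementable_zero: "implementable (\<lambda>X v. v i = 0)"
proof (rule implementable_atomI)
  fix s t
  have "acc Q s v = (v i = 0)" if "{I \<in> Q. src I = s} = {Zero s i}" for Q v
  proof -
    have *: "I \<in> Q \<Longrightarrow> src I = s \<Longrightarrow> I = Zero s i" for I using that by blast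
    have "Zero s i \<in> Q" using that by blast
    moreover have "v i = 0" if "acc Q s v" using that by cases (use * in force)+
    ultimately show ?thesis by (auto intro: acc.zero)
  qed
  then show "\<exists>P. finite P \<and> (\<forall>I\<in>P. src I = s) \<and>
    (\<forall>Q. {I \<in> Q. src I = s} = P \<longrightarrow> (\<forall>v. acc Q s v = (v i = 0)))"
    by (intro exI[of _ "{Zero s i}"]) simp
qed

lemma implementable_dec: "implementable (\<lambda>X v. \<exists>n. v i = Suc n \<and> X (v(i := n)))"
proof (rule implementable_atomI)
  fix s t
  have "acc Q s v = (\<exists>n. v i = Suc n \<and> acc Q t (v(i := n)))"
    if "{I \<in> Q. src I = s} = {Dec s i t}" for Q v
  proof -
    have *: "I \<in> Q \<Longrightarrow> src I = s \<Longrightarrow> I = Dec s i t" for I using that by blast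
    have "Dec s i t \<in> Q" using that by blast
    moreover have "\<exists>n. v i = Suc n \<and> acc Q t (v(i := n))" if "acc Q s v"
      using that by cases (use * in force)+
    ultimately show ?thesis by (auto intro: acc.dec)
  qed
  then show "\<exists>P. finite P \<and> (\<forall>I\<in>P. src I = s) \<and>
    (\<forall>Q. {I \<in> Q. src I = s} = P \<longrightarrow> (\<forall>v. acc Q s v = (\<exists>n. v i = Suc n \<and> acc Q t (v(i := n)))))"
    by (intro exI[of _ "{Dec s i t}"]) simp
qed

text \<open>\<open>Havoc\<close> returns to its own state, so a second instruction, a jump to
  \<open>t\<close>, leaves it. Overwriting may happen any number of times before that, but only the
  last value survives.\<close>

lemma implementable_havoc: "implementable (\<lambda>X v. \<exists>n. X (v(i := n)))"
proof (rule implementable_atomI)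
  fix s t
  have "acc Q s v = (\<exists>n. acc Q t (v(i := n)))"
    if "{I \<in> Q. src I = s} = {Havoc s i, Fork s t t}" for Q v
  proof -
    have *: "I \<in> Q \<Longrightarrow> src I = s \<Longrightarrow> I = Havoc s i \<or> I = Fork s t t" for I using that by blast
    have Q: "Havoc s i \<in> Q" "Fork s t t \<in> Q" using that by blast+
    have "q = s \<Longrightarrow> \<exists>n. acc Q t (v(i := n))" if "acc Q q v" for q v
      using that
    proof (induction rule: acc.induct)
      case (fork q q1 q2 v)
      then have "acc Q t v" using *[OF fork(1)] by auto
      then show ?case by (metis fun_upd_triv)
    next
      case (havoc q j v n)
      then have "j = i" using *[OF havoc(1)] by auto
      then show ?case using havoc by (metis fun_upd_upd)
    next
      case (dec q j q' v n)
      then show ?case using *[OF dec(1)] by auto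
    next
      case (zero q j v)
      then show ?case using *[OF zero(1)] by auto
    qed
    then show ?thesis using Q acc.fork acc.havoc by metis
  qed
  then show "\<exists>P. finite P \<and> (\<forall>I\<in>P. src I = s) \<and>
    (\<forall>Q. {I \<in> Q. src I = s} = P \<longrightarrow> (\<forall>v. acc Q s v = (\<exists>n. acc Q t (v(i := n)))))"
    by (intro exI[of _ "{Havoc s i, Fork s t t}"]) simp
qed

lemma implementable_id: "implementable (\<lambda>X. X)"
proof (rule implementable_atomI)
  fix s t
  have "acc Q s v = acc Q t v" if "{I \<in> Q. src I = s} = {Fork s t t}" for Q v
  proof -
    have *: "I \<in> Q \<Longrightarrow> src I = s \<Longrightarrow> I = Fork s t t" for I using that by blast
    have "Fork s t t \<in> Q" using that by blast
    moreover have "acc Q t v" if "acc Q s v" using that by cases (use * in force)+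
    ultimately show ?thesis by (auto intro: acc.fork)
  qed
  then show "\<exists>P. finite P \<and> (\<forall>I\<in>P. src I = s) \<and>
    (\<forall>Q. {I \<in> Q. src I = s} = P \<longrightarrow> (\<forall>v. acc Q s v = acc Q t v))"
    by (intro exI[of _ "{Fork s t t}"]) simp
qed

text \<open>State \<open>s\<close> branches, by the instructions \<open>H\<close>, into two blocks that start at \<open>Suc s\<close> and \<open>s1\<close>.
  The second block may also be left to the first one; \<open>t1\<close> selects its exit.\<close>

lemma implementable_glue:
  assumes \<Phi>: "implementable \<Phi>" and \<Psi>: "implementable \<Psi>"
    and H: "\<And>s s1 t. finite (H s s1 t) \<and> (\<forall>I\<in>H s s1 t. src I = s)"
    and t1: "\<And>s t. t1 s t = t \<or> t1 s t = Suc s"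
    and sem: "\<And>Q s s1 t v. \<lbrakk>{I \<in> Q. src I = s} = H s s1 t;
        \<And>v. acc Q (Suc s) v = \<Phi> (acc Q t) v;
        \<And>v. acc Q s1 v = \<Psi> (acc Q (t1 s t)) v\<rbrakk> \<Longrightarrow> acc Q s v = \<Theta> (acc Q t) v"
  shows "implementable \<Theta>"
  unfolding implementable_def
proof (intro allI)
  fix s t
  obtain s1 P1 where 1: "Suc s < s1" "finite P1" "src ` P1 \<subseteq> {Suc s..<s1}"
    "\<And>Q v. {I \<in> Q. src I \<in> {Suc s..<s1}} = P1 \<Longrightarrow> acc Q (Suc s) v = \<Phi> (acc Q t) v"
    by (rule implementableE[OF \<Phi>, of "Suc s" t]) (rule that)
  obtain s2 P2 where 2: "s1 < s2" "finite P2" "src ` P2 \<subseteq> {s1..<s2}"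
    "\<And>Q v. {I \<in> Q. src I \<in> {s1..<s2}} = P2 \<Longrightarrow> acc Q s1 v = \<Psi> (acc Q (t1 s t)) v"
    by (rule implementableE[OF \<Psi>, of s1 "t1 s t"]) (rule that)
  let ?P = "H s s1 t \<union> P1 \<union> P2"
  have "acc Q s v = \<Theta> (acc Q t) v" if Q: "{I \<in> Q. src I \<in> {s..<s2}} = ?P" for Q v
  proof (rule sem)
    have *: "I \<in> Q \<and> src I \<in> {s..<s2} \<longleftrightarrow> I \<in> H s s1 t \<or> I \<in> P1 \<or> I \<in> P2" for I
      using Q by blast
    have h: "I \<in> H s s1 t \<Longrightarrow> src I = s" for I using H by blast
    have p1: "I \<in> P1 \<Longrightarrow> Suc s \<le> src I \<and> src I < s1" for I using 1(3) by auto
    have p2: "I \<in> P2 \<Longrightarrow> s1 \<le> src I \<and> src I < s2" for I using 2(3) by auto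
    show "{I \<in> Q. src I = s} = H s s1 t"
    proof (rule set_eqI, unfold mem_Collect_eq)
      fix I
      show "(I \<in> Q \<and> src I = s) = (I \<in> H s s1 t)"
        using *[of I] h[of I] p1[of I] p2[of I] 1(1) 2(1) by auto
    qed
    have "{I \<in> Q. src I \<in> {Suc s..<s1}} = P1"
    proof (rule set_eqI, unfold mem_Collect_eq)
      fix I
      show "(I \<in> Q \<and> src I \<in> {Suc s..<s1}) = (I \<in> P1)"
        using *[of I] h[of I] p1[of I] p2[of I] 1(1) 2(1) by auto
    qed
    then show "acc Q (Suc s) v = \<Phi> (acc Q t) v" for v by (rule 1(4))
    have "{I \<in> Q. src I \<in> {s1..<s2}} = P2"
    proof (rule set_eqI, unfold mem_Collect_eq)
      fix I
      show "(I \<in> Q \<and> src I \<in> {s1..<s2}) = (I \<in> P2)"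
        using *[of I] h[of I] p1[of I] p2[of I] 1(1) 2(1) by auto
    qed
    then show "acc Q s1 v = \<Psi> (acc Q (t1 s t)) v" for v by (rule 2(4))
  qed
  moreover have "src ` ?P \<subseteq> {s..<s2}" using H 1(1,3) 2(1,3) by fastforce
  moreover have "finite ?P" using H 1(2) 2(2) by blast
  moreover have "s < s2" using 1(1) 2(1) by simp
  ultimately show "\<exists>s' P. s < s' \<and> finite P \<and> src ` P \<subseteq> {s..<s'} \<and>
     (\<forall>Q. {I \<in> Q. src I \<in> {s..<s'}} = P \<longrightarrow> (\<forall>v. acc Q s v = \<Theta> (acc Q t) v))"
    by (intro exI[of _ s2] exI[of _ ?P]) blast
qed

text \<open>The choice among forks is a disjunction of conjunctions, and a pair
  \<open>(a, a)\<close> is a plain jump. Conjunction, disjunction and sequencing of blocks are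
  instances.\<close>

lemma acc_forks:
  assumes "{I \<in> Q. src I = s} = (\<lambda>(a, b). Fork s a b) ` B"
  shows "acc Q s v \<longleftrightarrow> (\<exists>(a, b)\<in>B. acc Q a v \<and> acc Q b v)"
proof -
  have *: "\<exists>a b. (a, b) \<in> B \<and> I = Fork s a b" if "I \<in> Q" "src I = s" for I
  proof -
    have "I \<in> (\<lambda>(a, b). Fork s a b) ` B" using that assms by blast
    then show ?thesis by auto
  qed
  have "\<exists>(a, b)\<in>B. acc Q a v \<and> acc Q b v" if "acc Q s v"
    using that
  proof cases
    case (fork q1 q2)
    then show ?thesis using *[of "Fork s q1 q2"] by auto
  next
    case (havoc i n)
    then show ?thesis using *[of "Havoc s i"] by auto
  next
    case (dec i q' n)
    then show ?thesis using *[of "Dec s i q'"] by auto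
  next
    case (zero i)
    then show ?thesis using *[of "Zero s i"] by auto
  qed
  moreover have "acc Q s v" if "(a, b) \<in> B" "acc Q a v" "acc Q b v" for a b
  proof -
    have "Fork s a b \<in> (\<lambda>(a, b). Fork s a b) ` B" using that(1) by force
    then have "Fork s a b \<in> Q" using assms by blast
    then show ?thesis using that(2,3) by (rule acc.fork)
  qed
  ultimately show ?thesis by blast
qed

lemma implementable_conj:
  assumes "implementable \<Phi>" "implementable \<Psi>"
  shows "implementable (\<lambda>X v. \<Phi> X v \<and> \<Psi> X v)"
proof (rule implementable_glue[OF assms,
      where H = "\<lambda>s s1 t. (\<lambda>(a, b). Fork s a b) ` {(Suc s, s1)}" and ?t1.0 = "\<lambda>s t. t"])
  fix Q s s1 t v
  assume *: "{I \<in> Q. src I = s} = (\<lambda>(a, b). Fork s a b) ` {(Suc s, s1)}"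
    and "\<And>v. acc Q (Suc s) v = \<Phi> (acc Q t) v" "\<And>v. acc Q s1 v = \<Psi> (acc Q t) v"
  then show "acc Q s v = (\<Phi> (acc Q t) v \<and> \<Psi> (acc Q t) v)"
    unfolding acc_forks[OF *] by simp
qed auto

lemma implementable_disj:
  assumes "implementable \<Phi>" "implementable \<Psi>"
  shows "implementable (\<lambda>X v. \<Phi> X v \<or> \<Psi> X v)"
proof (rule implementable_glue[OF assms,
      where H = "\<lambda>s s1 t. (\<lambda>(a, b). Fork s a b) ` {(Suc s, Suc s), (s1, s1)}" and ?t1.0 = "\<lambda>s t. t"])
  fix Q s s1 t v
  assume *: "{I \<in> Q. src I = s} = (\<lambda>(a, b). Fork s a b) ` {(Suc s, Suc s), (s1, s1)}"
    and "\<And>v. acc Q (Suc s) v = \<Phi> (acc Q t) v" "\<And>v. acc Q s1 v = \<Psi> (acc Q t) v"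
  then show "acc Q s v = (\<Phi> (acc Q t) v \<or> \<Psi> (acc Q t) v)"
    unfolding acc_forks[OF *] by simp
qed auto

text \<open>The exit of a block must be known when the block is laid out. Hence the block of
  \<open>\<Psi>\<close>, which runs last, is placed first, at \<open>Suc s\<close>; the entry jumps
  over it to the block of \<open>\<Phi>\<close>, whose exit is \<open>Suc s\<close>.\<close>

lemma implementable_comp:
  assumes "implementable \<Phi>" "implementable \<Psi>"
  shows "implementable (\<lambda>X. \<Phi> (\<Psi> X))"
proof (rule implementable_glue[OF assms(2,1),
      where H = "\<lambda>s s1 t. (\<lambda>(a, b). Fork s a b) ` {(s1, s1)}" and ?t1.0 = "\<lambda>s t. Suc s"])
  fix Q s s1 t v
  assume *: "{I \<in> Q. src I = s} = (\<lambda>(a, b). Fork s a b) ` {(s1, s1)}"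
    and 1: "\<And>v. acc Q (Suc s) v = \<Psi> (acc Q t) v"
    and 2: "\<And>v. acc Q s1 v = \<Phi> (acc Q (Suc s)) v"
  have "acc Q (Suc s) = \<Psi> (acc Q t)" using 1 by (rule ext)
  then show "acc Q s v = \<Phi> (\<Psi> (acc Q t)) v"
    unfolding acc_forks[OF *] by (simp add: 2)
qed auto

text \<open>The block is left to its own entry. Every loop used here decrements a register, so its equation has only one solution.\<close>

lemma implementable_loop:
  assumes "implementable \<Phi>" and "\<And>X v. (\<And>v. X v = \<Phi> X v) \<Longrightarrow> X v = T v"
  shows "implementable (\<lambda>_. T)"
  unfolding implementable_def
proof (intro allI)
  fix s t
  obtain s' P where "s < s'" "finite P" "src ` P \<subseteq> {s..<s'}"
    "\<And>Q v. {I \<in> Q. src I \<in> {s..<s'}} = P \<Longrightarrow> acc Q s v = \<Phi> (acc Q s) v"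
    by (rule implementableE[OF assms(1), of s s]) (rule that)
  note P = this
  have "acc Q s v = T v" if "{I \<in> Q. src I \<in> {s..<s'}} = P" for Q v
    using assms(2)[of "acc Q s"] P(4)[OF that] by blast
  then show "\<exists>s' P. s < s' \<and> finite P \<and> src ` P \<subseteq> {s..<s'} \<and>
     (\<forall>Q. {I \<in> Q. src I \<in> {s..<s'}} = P \<longrightarrow> (\<forall>v. acc Q s v = T v))"
    using P(1-3) by (intro exI[of _ s'] exI[of _ P]) blast
qed

section \<open>Relations recognized by alternating machines\<close>

abbreviation recognizable :: "rel \<Rightarrow> bool" where
  "recognizable T \<equiv> implementable (\<lambda>_. T)"

lemma implementable_havoc_list:
  "implementable (\<lambda>X v. \<exists>w. (\<forall>x. x \<notin> set ys \<longrightarrow> w x = v x) \<and> X w)"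
proof (induction ys)
  case Nil
  have "(\<exists>w. (\<forall>x. w x = v x) \<and> X w) = X v" for X :: rel and v
    by (metis ext)
  then show ?case using implementable_id by simp
next
  case (Cons y ys)
  have "(\<exists>w. (\<forall>x. x \<notin> set (y # ys) \<longrightarrow> w x = v x) \<and> X w) \<longleftrightarrow>
      (\<exists>n w. (\<forall>x. x \<notin> set ys \<longrightarrow> w x = (v(y := n)) x) \<and> X w)" for X :: rel and v
  proof
    assume "\<exists>w. (\<forall>x. x \<notin> set (y # ys) \<longrightarrow> w x = v x) \<and> X w"
    then obtain w where "\<forall>x. x \<notin> set (y # ys) \<longrightarrow> w x = v x" "X w" by blast
    then show "\<exists>n w. (\<forall>x. x \<notin> set ys \<longrightarrow> w x = (v(y := n)) x) \<and> X w"
      by (intro exI[of _ "w y"] exI[of _ w]) auto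
  next
    assume "\<exists>n w. (\<forall>x. x \<notin> set ys \<longrightarrow> w x = (v(y := n)) x) \<and> X w"
    then obtain n w where "\<forall>x. x \<notin> set ys \<longrightarrow> w x = (v(y := n)) x" "X w" by blast
    then show "\<exists>w. (\<forall>x. x \<notin> set (y # ys) \<longrightarrow> w x = v x) \<and> X w"
      by (intro exI[of _ w]) auto
  qed
  then show ?case using implementable_comp[OF implementable_havoc[of y] Cons] by simp
qed

lemma recognizable_conj_list:
  assumes "\<And>T. T \<in> set Ts \<Longrightarrow> recognizable T"
  shows "recognizable (\<lambda>v. \<forall>T\<in>set Ts. T v)"
  using assms
proof (induction Ts)
  case Nil
  \<comment> \<open>Truth is obtained by overwriting register 0 with a guess and testing it for
    zero.\<close>
  have "recognizable (\<lambda>v. \<exists>n. (v(0 := n)) 0 = 0)"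
    using implementable_comp[OF implementable_havoc[of 0] implementable_zero[of 0]] .
  then have "recognizable (\<lambda>v. True)" by simp
  then show ?case by simp
next
  case (Cons T Ts)
  then show ?case using implementable_conj[of "\<lambda>_. T" "\<lambda>_ v. \<forall>T\<in>set Ts. T v"] by auto
qed

text \<open>Both registers are counted down in step and must reach zero together. For
  \<open>i = j\<close> this loop would decrement one register twice, whence the separate
  case.\<close>

lemma recognizable_eq: "recognizable (\<lambda>v. v i = v j)"
proof (cases "i = j")
  case True
  then show ?thesis using recognizable_conj_list[of "[]"] by simp
next
  case False
  let ?\<Phi> = "\<lambda>X v. (v i = 0 \<and> v j = 0) \<or>
      (\<exists>n. v i = Suc n \<and> (\<exists>m. (v(i := n)) j = Suc m \<and> X ((v(i := n))(j := m))))"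
  show ?thesis
  proof (rule implementable_loop)
    show "implementable ?\<Phi>"
      by (intro implementable_disj implementable_conj implementable_zero
          implementable_comp[OF implementable_dec[of i] implementable_dec[of j]])
  next
    fix X :: rel and v
    assume X: "\<And>v. X v = ?\<Phi> X v"
    show "X v = (v i = v j)"
    proof (induction "v i" arbitrary: v)
      case 0
      then show ?case by (subst X) auto
    next
      case (Suc n)
      have "X (v(i := n, j := m)) = (n = m)" for m
        using Suc(1)[of "v(i := n, j := m)"] False by simp
      then show ?case using False Suc(2)[symmetric] by (subst X) (auto simp del: fun_upd_apply, auto)
    qed
  qed
qed

lemma recognizable_True: "recognizable (\<lambda>v. True)"
  using recognizable_conj_list[of "[]"] by simp

lemma recognizable_False: "recognizable (\<lambda>v. False)"
proof -
  have "recognizable (\<lambda>v. v 0 = 0 \<and> (\<exists>n. v 0 = Suc n \<and> True))"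
    using implementable_conj[OF implementable_zero[of 0]
        implementable_comp[OF implementable_dec[of 0] recognizable_True]] .
  moreover have "(\<lambda>v :: nat \<Rightarrow> nat. v 0 = 0 \<and> (\<exists>n. v 0 = Suc n \<and> True)) = (\<lambda>v. False)"
    by auto
  ultimately show ?thesis by simp
qed

lemma recognizable_Suc: "recognizable (\<lambda>v. Suc (v i) = v j)"
proof (cases "i = j")
  case True
  then show ?thesis using recognizable_False by simp
next
  case False
  have "recognizable (\<lambda>v. \<exists>n. v j = Suc n \<and> (v(j := n)) i = (v(j := n)) j)"
    using implementable_comp[OF implementable_dec recognizable_eq] .
  moreover have "(\<exists>n. v j = Suc n \<and> (v(j := n)) i = (v(j := n)) j) = (Suc (v i) = v j)"
    for v :: "nat \<Rightarrow> nat"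
    using False by auto
  ultimately show ?thesis by simp
qed

lemma recognizable_conj:
  "recognizable S \<Longrightarrow> recognizable T \<Longrightarrow> recognizable (\<lambda>v. S v \<and> T v)"
  using implementable_conj by blast

text \<open>Auxiliary registers act as existential quantifiers: \<open>ys\<close> is guessed, then
  \<open>T\<close> is verified.\<close>

lemma recognizable_ex_list:
  assumes "recognizable T"
    and "\<And>v. S v \<longleftrightarrow> (\<exists>w. (\<forall>x. x \<notin> set ys \<longrightarrow> w x = v x) \<and> T w)"
  shows "recognizable S"
proof -
  have "S = (\<lambda>v. \<exists>w. (\<forall>x. x \<notin> set ys \<longrightarrow> w x = v x) \<and> T w)" using assms(2) by (rule ext)
  then show ?thesis using implementable_comp[OF implementable_havoc_list assms(1)] by simp
qed

lemma map_upd_notin [simp]: "x \<notin> set xs \<Longrightarrow> map (v(x := n)) xs = map v xs"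
  by (induction xs) auto

text \<open>The intermediate values are guessed in fresh registers. Each equation is verified on its
  own universal branch, so every branch finds the arguments intact.\<close>

lemma recognizable_recfn_compose:
  assumes f: "\<And>rs r. length rs = m \<Longrightarrow> recognizable (\<lambda>v. f (map v rs) = v r)"
    and gs: "\<And>g r. g \<in> set gs \<Longrightarrow> recognizable (\<lambda>v. g (map v rs) = v r)"
    and m: "length gs = m"
  shows "recognizable (\<lambda>v. f (map (\<lambda>g. g (map v rs)) gs) = v r)"
proof -
  \<comment> \<open>\<open>N\<close> exceeds the argument and result registers; the registers from
    \<open>N\<close> on are free.\<close>
  obtain N where N: "\<And>x. x \<in> set (r # rs) \<Longrightarrow> x < N"
    using finite_nat_set_iff_bounded[of "set (r # rs)"] by auto
  define ys where "ys = [N..<N + m]"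
  have r: "r \<notin> set ys" using N[of r] by (simp add: ys_def)
  have rs: "x \<notin> set ys" if "x \<in> set rs" for x using N[of x] that by (simp add: ys_def)
  define Ts where "Ts = map (\<lambda>i (v :: nat \<Rightarrow> nat). (gs ! i) (map v rs) = v (N + i)) [0..<m]"
  have Ts: "(\<forall>T\<in>set Ts. T v) \<longleftrightarrow> map (\<lambda>g. g (map v rs)) gs = map v ys" for v
  proof -
    have "(\<forall>T\<in>set Ts. T v) \<longleftrightarrow> (\<forall>i<m. (gs ! i) (map v rs) = v (N + i))"
      unfolding Ts_def by auto
    also have "\<dots> \<longleftrightarrow> map (\<lambda>g. g (map v rs)) gs = map v ys"
      using m unfolding list_eq_iff_nth_eq by (simp add: ys_def)
    finally show ?thesis .
  qed
  have "recognizable (\<lambda>v. \<forall>T\<in>set Ts. T v)"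
  proof (rule recognizable_conj_list)
    fix T assume "T \<in> set Ts"
    then obtain i where "i < m" "T = (\<lambda>v. (gs ! i) (map v rs) = v (N + i))" by (auto simp: Ts_def)
    then show "recognizable T" using gs[of "gs ! i" "N + i"] m by simp
  qed
  moreover have "recognizable (\<lambda>v. f (map v ys) = v r)" using f[of ys r] by (simp add: ys_def)
  ultimately have "recognizable (\<lambda>v. (\<forall>T\<in>set Ts. T v) \<and> f (map v ys) = v r)"
    by (rule recognizable_conj)
  then show ?thesis
  proof (rule recognizable_ex_list)
    fix v :: "nat \<Rightarrow> nat"
    show "(f (map (\<lambda>g. g (map v rs)) gs) = v r) \<longleftrightarrow> (\<exists>w. (\<forall>x. x \<notin> set ys \<longrightarrow> w x = v x) \<and>
      ((\<forall>T\<in>set Ts. T w) \<and> f (map w ys) = w r))" (is "?l = ?r")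
    proof
      assume ?l
      define w where "w = (\<lambda>x. if x \<in> set ys then (gs ! (x - N)) (map v rs) else v x)"
      have wr: "map w rs = map v rs" "w r = v r" using rs r by (simp_all add: w_def)
      have "map (\<lambda>g. g (map w rs)) gs = map w ys"
        unfolding wr using m by (auto simp: w_def ys_def list_eq_iff_nth_eq)
      moreover from this have "f (map w ys) = w r"
        using \<open>?l\<close> unfolding wr by simp
      moreover have "\<forall>x. x \<notin> set ys \<longrightarrow> w x = v x" by (simp add: w_def)
      ultimately show ?r unfolding Ts by blast
    next
      assume ?r
      then obtain w where w: "\<forall>x. x \<notin> set ys \<longrightarrow> w x = v x"
        "map (\<lambda>g. g (map w rs)) gs = map w ys" "f (map w ys) = w r" unfolding Ts by blast
      have "map w rs = map v rs" "w r = v r" using w(1) rs r by simp_all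
      then show ?l using w(2,3) by (simp del: map_eq_conv)
    qed
  qed
qed

text \<open>The recursion is unwound from the top: \<open>y\<close> always holds the value claimed
  at argument \<open>p\<close>. One round decrements \<open>p\<close>, guesses in \<open>z\<close>
  the value claimed there, verifies the step \<open>h\<close> on a separate branch, and continues
  with \<open>z\<close> copied to \<open>y\<close>.\<close>

lemma recognizable_prim_rec_loop:
  assumes g: "recognizable (\<lambda>v. g (map v rs) = v y)"
    and h: "recognizable (\<lambda>v. h (map v (p # z # rs)) = v y)"
    and fresh: "distinct [p, y, z]" "p \<notin> set rs" "y \<notin> set rs" "z \<notin> set rs"
  shows "recognizable (\<lambda>v. PR g h (v p # map v rs) = v y)"
proof -
  \<comment> \<open>Overwriting \<open>y\<close> and testing it against \<open>z\<close> is the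
    assignment of \<open>z\<close> to \<open>y\<close>.\<close>
  let ?body = "\<lambda>X v. \<exists>k. h (map (v(z := k)) (p # z # rs)) = (v(z := k)) y \<and>
      (\<exists>l. (v(z := k, y := l)) y = (v(z := k, y := l)) z \<and> X (v(z := k, y := l)))"
  let ?\<Phi> = "\<lambda>X v. (v p = 0 \<and> g (map v rs) = v y) \<or> (\<exists>n. v p = Suc n \<and> ?body X (v(p := n)))"
  have "implementable ?body"
    using implementable_comp[OF implementable_havoc[of z]
        implementable_conj[OF h implementable_comp[OF implementable_havoc[of y]
            implementable_conj[OF recognizable_eq[of y z] implementable_id]]]] .
  then have "implementable ?\<Phi>"
    using implementable_disj[OF implementable_conj[OF implementable_zero[of p] g]
        implementable_comp[OF implementable_dec[of p]]] by blast
  then show ?thesis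
  proof (rule implementable_loop)
    fix X :: rel and v
    assume X: "\<And>v. X v = ?\<Phi> X v"
    show "X v = (PR g h (v p # map v rs) = v y)"
    proof (induction "v p" arbitrary: v)
      case 0
      then show ?case by (subst X) auto
    next
      case (Suc n)
      have IH: "X (v(p := n, z := k, y := k)) = (PR g h (n # map v rs) = k)" for k
        using Suc(1)[of "v(p := n, z := k, y := k)"] fresh by simp
      have "X v = ?body X (v(p := n))" using Suc(2)[symmetric] by (subst X) auto
      also have "\<dots> = (\<exists>k. h (n # k # map v rs) = v y \<and> X (v(p := n, z := k, y := k)))"
        using fresh by (auto simp: fun_upd_twist)
      also have "\<dots> = (PR g h (v p # map v rs) = v y)"
        using fresh IH Suc(2)[symmetric] by auto
      finally show ?case .
    qed
  qed
qed

text \<open>The loop consumes the recursion argument and the claimed value, which may coincide with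
  other registers here. It therefore works on the copies \<open>N\<close> and \<open>Suc N\<close>,
  with \<open>Suc (Suc N)\<close> as scratch register.\<close>

lemma recognizable_prim_rec:
  assumes g: "\<And>rs r. length rs = n \<Longrightarrow> recognizable (\<lambda>v. g (map v rs) = v r)"
    and h: "\<And>rs r. length rs = n + 2 \<Longrightarrow> recognizable (\<lambda>v. h (map v rs) = v r)"
    and len: "length rs = Suc n"
  shows "recognizable (\<lambda>v. PR g h (map v rs) = v r)"
proof -
  obtain a as where rs: "rs = a # as" "length as = n" using len by (cases rs) auto
  obtain N where N: "\<And>x. x \<in> set (r # rs) \<Longrightarrow> x < N"
    using finite_nat_set_iff_bounded[of "set (r # rs)"] by auto
  have fresh: "N \<notin> set as" "Suc N \<notin> set as" "Suc (Suc N) \<notin> set as"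
    "a < N" "r < N" using N rs by force+
  have "recognizable (\<lambda>v. v N = v a \<and> v (Suc N) = v r \<and> PR g h (v N # map v as) = v (Suc N))"
    using fresh rs(2)
    by (intro recognizable_conj recognizable_eq recognizable_prim_rec_loop[where z = "Suc (Suc N)"] g h) auto
  then show ?thesis
  proof (rule recognizable_ex_list[where ys = "[N, Suc N]"])
    fix v :: "nat \<Rightarrow> nat"
    show "(PR g h (map v rs) = v r) \<longleftrightarrow> (\<exists>w. (\<forall>x. x \<notin> set [N, Suc N] \<longrightarrow> w x = v x) \<and>
      (w N = w a \<and> w (Suc N) = w r \<and> PR g h (w N # map w as) = w (Suc N)))" (is "?l = ?r")
    proof
      assume ?l
      then show ?r using fresh rs
        by (intro exI[of _ "v(N := v a, Suc N := v r)"]) auto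
    next
      assume ?r
      then obtain w where w: "\<forall>x. x \<notin> set [N, Suc N] \<longrightarrow> w x = v x"
        "w N = w a" "w (Suc N) = w r" "PR g h (w N # map w as) = w (Suc N)" by blast
      have "map w as = map v as" using w(1) fresh by auto
      moreover have "w a = v a" "w r = v r" using w(1) fresh by auto
      ultimately show ?l using w(2-) rs by (simp del: map_eq_conv)
    qed
  qed
qed

text \<open>That a value is nonzero is verified positively: it is guessed in \<open>z\<close>, and
  \<open>z\<close> is decremented once. The bounded universal quantifier is a countdown of
  \<open>p\<close> with one such branch per round.\<close>

lemma recognizable_minimize_loop:
  assumes f: "recognizable (\<lambda>v. f (map v (p # rs)) = v z)"
    and fresh: "p \<noteq> z" "p \<notin> set rs" "z \<notin> set rs"
  shows "recognizable (\<lambda>v. \<forall>j<v p. f (j # map v rs) \<noteq> 0)"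
proof -
  let ?body = "\<lambda>v. \<exists>k. f (map (v(z := k)) (p # rs)) = (v(z := k)) z \<and>
      (\<exists>l. (v(z := k)) z = Suc l \<and> True)"
  let ?\<Phi> = "\<lambda>X v. v p = 0 \<or> (\<exists>n. v p = Suc n \<and> (?body (v(p := n)) \<and> X (v(p := n))))"
  have "recognizable ?body"
    using implementable_comp[OF implementable_havoc[of z]
        implementable_conj[OF f implementable_comp[OF implementable_dec[of z] recognizable_True]]] .
  then have "implementable ?\<Phi>"
    using implementable_disj[OF implementable_zero[of p]
        implementable_comp[OF implementable_dec[of p] implementable_conj[OF _ implementable_id]]]
    by blast
  then show ?thesis
  proof (rule implementable_loop)
    fix X :: rel and v
    assume X: "\<And>v. X v = ?\<Phi> X v"
    show "X v = (\<forall>j<v p. f (j # map v rs) \<noteq> 0)"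
    proof (induction "v p" arbitrary: v)
      case 0
      then show ?case by (subst X) auto
    next
      case (Suc n)
      have "X (v(p := n)) = (\<forall>j<n. f (j # map v rs) \<noteq> 0)"
        using Suc(1)[of "v(p := n)"] fresh by simp
      moreover have "?body (v(p := n)) = (f (n # map v rs) \<noteq> 0)"
        using fresh by (auto simp: gr0_conv_Suc)
      ultimately show ?case using Suc(2)[symmetric] by (subst X) (auto simp: less_Suc_eq)
    qed
  qed
qed

text \<open>By totality, the least zero is \<open>r\<close> iff \<open>r\<close> is a zero and no
  smaller number is. \<open>N\<close> is a copy of \<open>r\<close> for the countdown,
  \<open>Suc N\<close> holds the zero with which the value of \<open>f\<close> is compared.\<close>

lemma recognizable_minimize:
  assumes f: "\<And>rs r. length rs = Suc n \<Longrightarrow> recognizable (\<lambda>v. f (map v rs) = v r)"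
    and total: "\<forall>xs. length xs = n \<longrightarrow> (\<exists>y. f (y # xs) = 0)"
    and len: "length rs = n"
  shows "recognizable (\<lambda>v. (LEAST y. f (y # map v rs) = 0) = v r)"
proof -
  obtain N where N: "\<And>x. x \<in> set (r # rs) \<Longrightarrow> x < N"
    using finite_nat_set_iff_bounded[of "set (r # rs)"] by auto
  have fresh: "N \<notin> set rs" "Suc N \<notin> set rs" "r < N" using N by force+
  have least: "(LEAST y. P y) = m \<longleftrightarrow> P m \<and> (\<forall>j<m. \<not> P j)" if "\<exists>y. P y"
    for P :: "nat \<Rightarrow> bool" and m
    using that by (metis LeastI_ex not_less_Least linorder_neqE_nat)
  have "recognizable (\<lambda>v. v N = v r \<and> v (Suc N) = 0 \<and> f (map v (N # rs)) = v (Suc N) \<and>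
      (\<forall>j<v N. f (j # map v rs) \<noteq> 0))"
    using fresh len
    by (intro recognizable_conj recognizable_eq implementable_zero
        recognizable_minimize_loop[where z = "Suc N"] f) auto
  then show ?thesis
  proof (rule recognizable_ex_list[where ys = "[N, Suc N]"])
    fix v :: "nat \<Rightarrow> nat"
    have "\<exists>y. f (y # map v rs) = 0" using total len by simp
    note least = least[of "\<lambda>y. f (y # map v rs) = 0", OF this]
    show "((LEAST y. f (y # map v rs) = 0) = v r) \<longleftrightarrow>
      (\<exists>w. (\<forall>x. x \<notin> set [N, Suc N] \<longrightarrow> w x = v x) \<and> (w N = w r \<and> w (Suc N) = 0 \<and>
        f (map w (N # rs)) = w (Suc N) \<and> (\<forall>j<w N. f (j # map w rs) \<noteq> 0)))" (is "?l = ?r")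
    proof
      assume ?l
      then show ?r using fresh unfolding least
        by (intro exI[of _ "v(N := v r, Suc N := 0)"]) auto
    next
      assume ?r
      then obtain w where w: "\<forall>x. x \<notin> set [N, Suc N] \<longrightarrow> w x = v x"
        "w N = w r" "w (Suc N) = 0" "f (map w (N # rs)) = w (Suc N)"
        "\<forall>j<w N. f (j # map w rs) \<noteq> 0" by blast
      have "map w rs = map v rs" using w(1) fresh by auto
      moreover have "w r = v r" using w(1) fresh by auto
      ultimately show ?l using w(2-) unfolding least by (simp del: map_eq_conv)
    qed
  qed
qed

text \<open>The registers \<open>rs\<close> and \<open>r\<close> are arbitrary, so that the cases of
  the induction can run their subcomputations in registers of their own choice.\<close>

lemma recognizable_recfn:
  assumes "recfn n f" "length rs = n"
  shows "recognizable (\<lambda>v. f (map v rs) = v r)"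
  using assms
proof (induction arbitrary: rs r)
  case (zero n)
  have "(\<lambda>v :: nat \<Rightarrow> nat. 0 = v r) = (\<lambda>v. v r = 0)" by auto
  then show ?case using implementable_zero[of r] by simp
next
  case succ
  then obtain a where "rs = [a]" by (cases rs) auto
  then show ?case using recognizable_Suc[of a r] by simp
next
  case (proj i n)
  then show ?case using recognizable_eq[of "rs ! i" r] by simp
next
  case (compose m f gs n)
  then show ?case using recognizable_recfn_compose[of m f gs rs r] by blast
next
  case (prim_rec n g h)
  then show ?case using recognizable_prim_rec[of n g h rs r] by blast
next
  case (minimize n f)
  then show ?case using recognizable_minimize[of n f rs r] by blast
qed

lemma recfn_zero_program:
  assumes "recfn 1 g"
  obtains P where "finite P" "\<And>v. acc P 0 v \<longleftrightarrow> g [v 0] = 0"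
proof -
  have "recognizable (\<lambda>v. \<exists>n. (v(1 := n)) 1 = 0 \<and> g (map (v(1 := n)) [0]) = (v(1 := n)) 1)"
    using implementable_comp[OF implementable_havoc[of 1]
        implementable_conj[OF implementable_zero[of 1] recognizable_recfn[OF assms, of "[0]" 1]]]
    by simp
  then have "recognizable (\<lambda>v. g [v 0] = 0)" by simp
  \<comment> \<open>A recognizable relation is the same for every exit, so \<open>0\<close> is taken
    for the exit as well as for the entry; the block alone is then the whole program.\<close>
  then obtain s' P where P: "finite P" "src ` P \<subseteq> {0..<s'}"
    "\<And>Q v. {I \<in> Q. src I \<in> {0..<s'}} = P \<Longrightarrow> acc Q 0 v = (g [v 0] = 0)"
    by (rule implementableE[of _ 0 0]) (rule that)
  have "{I \<in> P. src I \<in> {0..<s'}} = P" using P(2) by auto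
  then show thesis using that P by blast
qed

section \<open>Computable functions\<close>

text \<open>\<open>recfn\<close> singles out functions on lists of all lengths. Comparing values on
  lists of length \<open>n\<close> only makes room for convenient closed forms.\<close>

definition computable :: "nat \<Rightarrow> (nat list \<Rightarrow> nat) \<Rightarrow> bool" where
  "computable n \<phi> \<longleftrightarrow> (\<exists>f. recfn n f \<and> (\<forall>xs. length xs = n \<longrightarrow> f xs = \<phi> xs))"

lemma computableI: "recfn n f \<Longrightarrow> (\<And>xs. length xs = n \<Longrightarrow> f xs = \<phi> xs) \<Longrightarrow> computable n \<phi>"
  unfolding computable_def by blast

lemma computable_proj: "i < n \<Longrightarrow> computable n (\<lambda>xs. xs ! i)"
  by (rule computableI[OF recfn.proj]) auto

lemma computable_compose1:
  assumes "computable 1 f" "computable n \<phi>"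
  shows "computable n (\<lambda>xs. f [\<phi> xs])"
proof -
  obtain F G where F: "recfn 1 F" "\<forall>xs. length xs = 1 \<longrightarrow> F xs = f xs"
    and G: "recfn n G" "\<forall>xs. length xs = n \<longrightarrow> G xs = \<phi> xs"
    using assms unfolding computable_def by blast
  have "recfn n (\<lambda>xs. F (map (\<lambda>g. g xs) [G]))"
    by (rule recfn.compose[OF F(1)]) (use G in auto)
  then show ?thesis by (rule computableI) (use F G in auto)
qed

lemma computable_compose2:
  assumes "computable 2 f" "computable n \<phi>" "computable n \<psi>"
  shows "computable n (\<lambda>xs. f [\<phi> xs, \<psi> xs])"
proof -
  obtain F G H where F: "recfn 2 F" "\<forall>xs. length xs = 2 \<longrightarrow> F xs = f xs"
    and G: "recfn n G" "\<forall>xs. length xs = n \<longrightarrow> G xs = \<phi> xs"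
    and H: "recfn n H" "\<forall>xs. length xs = n \<longrightarrow> H xs = \<psi> xs"
    using assms unfolding computable_def by blast
  have "recfn n (\<lambda>xs. F (map (\<lambda>g. g xs) [G, H]))"
    by (rule recfn.compose[OF F(1)]) (use G H in auto)
  then show ?thesis by (rule computableI) (use F G H in auto)
qed

lemma computable_Suc:
  assumes "computable n \<phi>"
  shows "computable n (\<lambda>xs. Suc (\<phi> xs))"
proof -
  have "computable 1 (\<lambda>xs. Suc (hd xs))" by (rule computableI[OF recfn.succ]) simp
  from computable_compose1[OF this assms] show ?thesis by simp
qed

lemma computable_const: "computable n (\<lambda>_. c)"
proof (induction c)
  case 0
  show ?case by (rule computableI[OF recfn.zero]) simp
next
  case (Suc c)
  then show ?case by (rule computable_Suc)
qed

lemma computable_prim_rec: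
  assumes "computable n \<gamma>" "computable (n + 2) \<eta>"
    and "\<And>xs. length xs = n \<Longrightarrow> \<phi> (0 # xs) = \<gamma> xs"
    and "\<And>y xs. length xs = n \<Longrightarrow> \<phi> (Suc y # xs) = \<eta> (y # \<phi> (y # xs) # xs)"
  shows "computable (Suc n) \<phi>"
proof -
  obtain G H where G: "recfn n G" "\<forall>xs. length xs = n \<longrightarrow> G xs = \<gamma> xs"
    and H: "recfn (n + 2) H" "\<forall>xs. length xs = n + 2 \<longrightarrow> H xs = \<eta> xs"
    using assms(1,2) unfolding computable_def by blast
  have *: "PR G H (y # xs) = \<phi> (y # xs)" if "length xs = n" for y xs
    by (induction y) (use that G H assms(3,4) in auto)
  show ?thesis
    by (rule computableI[OF recfn.prim_rec[OF G(1) H(1)]]) (use * in \<open>auto simp: length_Suc_conv\<close>)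
qed

lemma computable_add:
  assumes "computable n \<phi>" "computable n \<psi>"
  shows "computable n (\<lambda>xs. \<phi> xs + \<psi> xs)"
proof -
  have "computable (Suc 1) (\<lambda>xs. xs ! 0 + xs ! 1)"
    by (rule computable_prim_rec[where \<gamma> = "\<lambda>xs. xs ! 0" and \<eta> = "\<lambda>xs. Suc (xs ! 1)"])
      (auto intro: computable_proj computable_Suc)
  then have "computable 2 (\<lambda>xs. xs ! 0 + xs ! 1)" by (simp add: numeral_2_eq_2)
  from computable_compose2[OF this assms] show ?thesis by simp
qed

lemma computable_prod_encode:
  assumes "computable n \<phi>" "computable n \<psi>"
  shows "computable n (\<lambda>xs. prod_encode (\<phi> xs, \<psi> xs))"
proof -
  have "computable (Suc 0) (\<lambda>xs. triangle (xs ! 0))"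
    by (rule computable_prim_rec[where \<gamma> = "\<lambda>xs. 0" and \<eta> = "\<lambda>xs. xs ! 1 + Suc (xs ! 0)"])
      (auto intro!: computable_const computable_add computable_proj computable_Suc)
  then have "computable 1 (\<lambda>xs. triangle (xs ! 0))" by simp
  from computable_compose1[OF this computable_add[OF assms]]
  have "computable n (\<lambda>xs. triangle (\<phi> xs + \<psi> xs) + \<phi> xs)"
    using assms(1) by (auto intro: computable_add)
  then show ?thesis by (simp add: prod_encode_def)
qed

text \<open>Serves to compute the code of a comb with a given number of tallies, which is an iterate
  of a pairing function.\<close>

lemma computable_iterate:
  assumes "computable 1 (\<lambda>xs. h (xs ! 0))" and "computable 1 \<phi>"
  shows "computable 1 (\<lambda>xs. (h ^^ \<phi> xs) c)"
proof -
  have h: "computable 2 (\<lambda>xs. h (xs ! 1))"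
    using computable_compose1[OF assms(1) computable_proj[of 1 2]] by simp
  have "computable (Suc 0) (\<lambda>xs. (h ^^ (xs ! 0)) c)"
    by (rule computable_prim_rec[where \<gamma> = "\<lambda>xs. c" and \<eta> = "\<lambda>xs. h (xs ! 1)"])
      (use h in \<open>auto intro: computable_const simp: numeral_2_eq_2\<close>)
  then have "computable 1 (\<lambda>xs. (h ^^ (xs ! 0)) c)" by simp
  from computable_compose1[OF this assms(2)] show ?thesis by simp
qed

section \<open>From accepting runs to derivations\<close>

text \<open>A configuration is a state token composed with one comb \<open>((t \<circ> b) \<circ> b) \<circ> \<dots>\<close> per register, whose
  token \<open>t\<close> sits at the deep end, so that state and registers cannot see each other. A conditional move
  \<open>p \<Rightarrow> p'\<close> is therefore encoded as \<open>p \<Rightarrow> p' \<or> c\<close>: in the branch of the check token \<open>c\<close> the whole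
  configuration has to collapse to the goal, which the rules permit only if the condition holds.
  \<open>AskIdle\<close> and \<open>AskDone i\<close> are the checks of the state, \<open>Query s\<close> (``the state token is \<open>s\<close>'') those of
  the registers. A decrement is a handshake: the register goes from \<open>Idle\<close> to \<open>Done\<close>, the state to
  \<open>Mid\<close>, the register back to \<open>Idle\<close>, the state to its target. \<open>IdleX\<close> and \<open>DoneX\<close> absorb tallies and
  occur in checks only.\<close>

datatype tok = State nat | Mid nat nat | AskIdle | AskDone nat
  | Idle | Done | IdleX | DoneX | Query tok

text \<open>In \<open>Tok j t\<close> the index \<open>0\<close> stands for the state and \<open>Suc i\<close> for register \<open>i\<close>.\<close>

datatype atom = Goal | Tally nat | Tok nat tok

instance tok :: countable by countable_datatype
instance atom :: countable by countable_datatype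

section \<open>The rewrite rules of a program\<close>

definition atm :: "atom \<Rightarrow> fm" where
  "atm a = FVar (to_nat a)"

abbreviation stt :: "tok \<Rightarrow> fm" where "stt s \<equiv> atm (Tok 0 s)"
abbreviation rgt :: "nat \<Rightarrow> tok \<Rightarrow> fm" where "rgt i t \<equiv> atm (Tok (Suc i) t)"
abbreviation tally :: "nat \<Rightarrow> fm" where "tally i \<equiv> atm (Tally i)"
abbreviation goal :: fm where "goal \<equiv> atm Goal"

text \<open>The product formula of a configuration without tallies. The head of the list is the
  outermost factor, as in \<open>cfg\<close>, so over \<open>[0..<k]\<close> register 0 is
  outermost.\<close>

fun pattern :: "tok \<Rightarrow> (nat \<Rightarrow> tok) \<Rightarrow> nat list \<Rightarrow> fm" where
  "pattern s g [] = stt s"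
| "pattern s g (r # rs) = Prod (pattern s g rs) (rgt r (g r))"

text \<open>A query token swallows the tallies of its own register, and the whole configuration
  collapses once all other registers are erased from \<open>Idle\<close>. It thus checks both that
  the state token is \<open>s\<close> and that the other registers are idle.\<close>

fun query_rules :: "nat \<Rightarrow> nat \<Rightarrow> tok \<Rightarrow> (fm \<times> fm) list" where
  "query_rules k i s =
    [(Prod (rgt i (Query s)) (tally i), rgt i (Query s)),
     (pattern s ((\<lambda>_. IdleX)(i := Query s)) [0..<k], goal)]"

text \<open>\<open>AskIdle\<close> keeps the state from moving on while a register is still
  \<open>Done\<close>. \<open>Havoc\<close> changes a register by one tally in either direction,
  each time under a query of the state. \<open>Zero\<close> needs no check branch: its pattern spans
  the whole configuration and leaves register \<open>i\<close> unerased, hence without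
  tallies.\<close>

fun instr_rules :: "nat \<Rightarrow> instr \<Rightarrow> (fm \<times> fm) list" where
  "instr_rules k (Fork q q1 q2) =
    [(stt (State q), Join (stt (State q1)) (Join (stt (State q2)) (stt AskIdle)))]"
| "instr_rules k (Havoc q i) =
    [(rgt i Idle, Join (Prod (rgt i Idle) (tally i)) (rgt i (Query (State q)))),
     (Prod (rgt i Idle) (tally i), Join (rgt i Idle) (rgt i (Query (State q))))]
    @ query_rules k i (State q)"
| "instr_rules k (Dec q i q') =
    [(Prod (rgt i Idle) (tally i), Join (rgt i Done) (rgt i (Query (State q)))),
     (stt (State q), Join (stt (Mid i q')) (stt (AskDone i))),
     (rgt i Done, Join (rgt i Idle) (rgt i (Query (Mid i q')))),
     (stt (Mid i q'), Join (stt (State q')) (stt AskIdle))]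
    @ query_rules k i (State q) @ query_rules k i (Mid i q')"
| "instr_rules k (Zero q i) =
    [(pattern (State q) ((\<lambda>_. IdleX)(i := Idle)) [0..<k], goal)]"

text \<open>Erasure is one-way and remembers whether the register was \<open>Idle\<close> or
  \<open>Done\<close>, which is all that the checks inspect.\<close>

definition register_rules :: "nat \<Rightarrow> nat \<Rightarrow> (fm \<times> fm) list" where
  "register_rules k i =
    [(rgt i Idle, rgt i IdleX), (Prod (rgt i IdleX) (tally i), rgt i IdleX),
     (rgt i Done, rgt i DoneX), (Prod (rgt i DoneX) (tally i), rgt i DoneX),
     (pattern (AskDone i) ((\<lambda>_. IdleX)(i := DoneX)) [0..<k], goal)]"

definition rules :: "nat \<Rightarrow> instr list \<Rightarrow> (fm \<times> fm) list" where
  "rules k Is = (pattern AskIdle (\<lambda>_. IdleX) [0..<k], goal) #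
    concat (map (register_rules k) [0..<k]) @ concat (map (instr_rules k) Is)"

fun Meets :: "fm list \<Rightarrow> fm" where
  "Meets [] = FOne"
| "Meets (a # as) = Meet a (Meets as)"

definition bang_rules :: "(fm \<times> fm) list \<Rightarrow> fm" where
  "bang_rules Rs = Bang (Meets (map (\<lambda>(l, r). Ldiv l r) Rs))"

fun reg :: "nat \<Rightarrow> tok \<Rightarrow> nat \<Rightarrow> st" where
  "reg i t 0 = SF (rgt i t)"
| "reg i t (Suc n) = SC (reg i t n) (SF (tally i))"

fun cfg :: "tok \<Rightarrow> (nat \<Rightarrow> tok \<times> nat) \<Rightarrow> nat list \<Rightarrow> st" where
  "cfg s f [] = SF (stt s)"
| "cfg s f (r # rs) = SC (cfg s f rs) (reg r (fst (f r)) (snd (f r)))"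

section \<open>Structures, contexts and the mobility of banged formulas\<close>

lemma comp_SE [simp]: "comp SE x = x" "comp x SE = x"
  by (simp_all add: comp_def)

lemma comp_nonempty: "x \<noteq> SE \<Longrightarrow> y \<noteq> SE \<Longrightarrow> comp x y = SC x y"
  by (simp add: comp_def)

lemma wf_comp [simp]: "wf_st x \<Longrightarrow> wf_st y \<Longrightarrow> wf_st (comp x y)"
  by (simp add: comp_def)

lemma wf_fill [simp]: "wf_ctx u \<Longrightarrow> wf_st x \<Longrightarrow> wf_st (fill u x)"
  by (induction u) auto

fun plug :: "ctx \<Rightarrow> ctx \<Rightarrow> ctx" where
  "plug Hole v = v"
| "plug (CL u y) v = CL (plug u v) y"
| "plug (CR y u) v = CR y (plug u v)"

lemma fill_plug [simp]: "fill (plug u v) x = fill u (fill v x)"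
  by (induction u) auto

lemma wf_plug [simp]: "wf_ctx (plug u v) \<longleftrightarrow> wf_ctx u \<and> wf_ctx v"
  by (induction u) auto

lemma reg_neq_SE [simp]: "reg i t n \<noteq> SE" "SE \<noteq> reg i t n"
  by (cases n; simp)+

lemma wf_reg [simp]: "wf_st (reg i t n)"
  by (induction n) auto

lemma cfg_neq_SE [simp]: "cfg s f rs \<noteq> SE" "SE \<noteq> cfg s f rs"
  by (cases rs; simp)+

lemma wf_cfg [simp]: "wf_st (cfg s f rs)"
  by (induction rs) auto

fun st_of :: "fm \<Rightarrow> st" where
  "st_of (Prod a b) = SC (st_of a) (st_of b)"
| "st_of a = SF a"

text \<open>The structures left over when joins at the top of a formula and then the products below
  them are decomposed by their left rules.\<close>

fun alternatives :: "fm \<Rightarrow> st set" where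
  "alternatives (Join a b) = alternatives a \<union> alternatives b"
| "alternatives a = {st_of a}"

lemma st_of_atm [simp]: "st_of (atm a) = SF (atm a)" "alternatives (atm a) = {SF (atm a)}"
  by (simp_all add: atm_def)

lemma st_of_neq_SE [simp]: "st_of a \<noteq> SE" "SE \<noteq> st_of a"
  by (cases a; simp)+

lemma wf_st_of [simp]: "wf_st (st_of a)"
  by (induction a) auto

lemma st_of_pattern: "st_of (pattern s g rs) = cfg s (\<lambda>i. (g i, 0)) rs"
  by (induction rs) auto

lemma prov_st_of: "prov R (st_of a) (Some a)"
proof (induction a)
  case (Prod a b)
  then have "prov R (comp (st_of a) (st_of b)) (Some (Prod a b))" by (intro prov.prodR) auto
  then show ?case by (simp add: comp_nonempty)
qed (auto intro: prov.ax)

text \<open>Read from the conclusion, \<open>k\<close> travels from the front of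
  \<open>fill u x\<close> to the right of \<open>x\<close>, one layer of \<open>u\<close> at a time:
  \<open>ka1\<close> takes it into a left factor, while \<open>ke\<close> and \<open>ka2\<close>
  take it into a right one. The outer context \<open>w\<close> collects the layers already
  passed.\<close>

lemma prov_k_outwards:
  assumes k: "is_k k" and "wf_ctx u" "wf_ctx w" "wf_st x"
    and "prov R (fill w (fill u (comp x k))) d"
  shows "prov R (fill w (comp k (fill u x))) d"
  using assms(2-)
proof (induction u arbitrary: w)
  case Hole
  then show ?case using prov.ke2[OF k, of x w] by simp
next
  case (CL u y)
  then have "prov R (fill w (comp (comp k (fill u x)) y)) d"
    using CL.IH[of "plug w (CL Hole y)"] by simp
  then show ?case using prov.ka1a[OF k, of "fill u x" y w] CL.prems by simp
next
  case (CR y u)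
  let ?x = "fill u x" and ?w = "plug w (CR y Hole)"
  have "prov R (fill ?w (comp k ?x)) d" using CR.IH[of ?w] CR.prems by simp
  then have "prov R (fill ?w (comp ?x k)) d"
    using prov.ke1[OF k, of ?x ?w] CR.prems by simp
  then have "prov R (fill w (comp (comp y ?x) k)) d"
    using prov.ka2b[OF k, of y ?x w] CR.prems by simp
  then show ?case using prov.ke2[OF k, of "comp y ?x" w] CR.prems by simp
qed

lemma prov_Meets:
  assumes "a \<in> set as" "wf_ctx u" "prov R (fill u (SF a)) d"
  shows "prov R (fill u (SF (Meets as))) d"
  using assms by (induction as) (auto intro: prov.meetL1 prov.meetL2)

lemma is_k_bang_rules: "is_k (SF (bang_rules Rs))"
  by (simp add: is_k_def bang_rules_def)

section \<open>Backward rewriting in arbitrary contexts\<close>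

definition derivable :: "srule set \<Rightarrow> (fm \<times> fm) list \<Rightarrow> st \<Rightarrow> bool" where
  "derivable R Rs x \<longleftrightarrow> prov R (comp (SF (bang_rules Rs)) x) (Some goal)"

text \<open>One step of an alternating rewrite system, read backwards: \<open>y\<close> may be
  replaced by all members of \<open>S\<close> at once. The quantifier over contexts lets steps deep
  inside a configuration be chained.\<close>

definition covers :: "srule set \<Rightarrow> (fm \<times> fm) list \<Rightarrow> st set \<Rightarrow> st \<Rightarrow> bool" where
  "covers R Rs S y \<longleftrightarrow> (\<forall>u. wf_ctx u \<longrightarrow>
     (\<forall>x\<in>S. derivable R Rs (fill u x)) \<longrightarrow> derivable R Rs (fill u y))"

lemma coversI:
  assumes "\<And>u. \<lbrakk>wf_ctx u; \<And>x. x \<in> S \<Longrightarrow> derivable R Rs (fill u x)\<rbrakk> \<Longrightarrow> derivable R Rs (fill u y)"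
  shows "covers R Rs S y"
  using assms unfolding covers_def by blast

lemma coversD:
  "covers R Rs S y \<Longrightarrow> (\<And>x. x \<in> S \<Longrightarrow> derivable R Rs x) \<Longrightarrow> derivable R Rs y"
  unfolding covers_def by (metis fill.simps(1) wf_ctx.simps(1))

lemma covers_refl: "y \<in> S \<Longrightarrow> covers R Rs S y"
  unfolding covers_def by blast

lemma covers_trans:
  "covers R Rs S y \<Longrightarrow> (\<And>x. x \<in> S \<Longrightarrow> covers R Rs T x) \<Longrightarrow> covers R Rs T y"
  unfolding covers_def by blast

lemma covers_fill:
  assumes "covers R Rs S y" "wf_ctx v"
  shows "covers R Rs (fill v ` S) (fill v y)"
  using assms(1) unfolding covers_def
proof (intro allI impI)
  fix u
  assume *: "\<forall>u. wf_ctx u \<longrightarrow> (\<forall>x\<in>S. derivable R Rs (fill u x)) \<longrightarrow> derivable R Rs (fill u y)"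
    and "wf_ctx u" "\<forall>x\<in>fill v ` S. derivable R Rs (fill u x)"
  then show "derivable R Rs (fill u (fill v y))"
    using *[rule_format, of "plug u v"] assms(2) by auto
qed

lemma covers_SC:
  assumes "covers R Rs S y" "wf_st z" "z \<noteq> SE" "y \<noteq> SE" "SE \<notin> S"
  shows "covers R Rs ((\<lambda>x. SC x z) ` S) (SC y z)" "covers R Rs ((\<lambda>x. SC z x) ` S) (SC z y)"
proof -
  have "fill (CL Hole z) ` S = (\<lambda>x. SC x z) ` S" "fill (CR z Hole) ` S = (\<lambda>x. SC z x) ` S"
    using assms by (auto simp: comp_def intro!: image_cong)
  then show "covers R Rs ((\<lambda>x. SC x z) ` S) (SC y z)" "covers R Rs ((\<lambda>x. SC z x) ` S) (SC z y)"
    using covers_fill[OF assms(1), of "CL Hole z"] covers_fill[OF assms(1), of "CR z Hole"] assms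
    by (auto simp: comp_nonempty)
qed

lemma covers_alternatives: "covers R Rs (alternatives a) (SF a)"
proof -
  have left: "covers R Rs {st_of a} (SF a)" for a
  proof (induction a)
    case (Prod a b)
    have 1: "covers R Rs {SC (SF a) (SF b)} (SF (Prod a b))"
    proof (rule coversI)
      fix u assume u: "wf_ctx u" "\<And>x. x \<in> {SC (SF a) (SF b)} \<Longrightarrow> derivable R Rs (fill u x)"
      then show "derivable R Rs (fill u (SF (Prod a b)))"
        using prov.prodL[of "CR (SF (bang_rules Rs)) u" R a b] by (simp add: derivable_def)
    qed
    have 2: "covers R Rs {SC (st_of a) (SF b)} (SC (SF a) (SF b))"
      using covers_SC(1)[OF Prod(1), of "SF b"] by simp
    have 3: "covers R Rs {SC (st_of a) (st_of b)} (SC (st_of a) (SF b))"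
      using covers_SC(2)[OF Prod(2), of "st_of a"] by simp
    show ?case using 1 2 3 by (metis covers_trans singletonD st_of.simps(1))
  qed (auto intro: covers_refl)
  show ?thesis
  proof (induction a)
    case (Join a b)
    have 1: "covers R Rs {SF a, SF b} (SF (Join a b))"
    proof (rule coversI)
      fix u assume u: "wf_ctx u" "\<And>x. x \<in> {SF a, SF b} \<Longrightarrow> derivable R Rs (fill u x)"
      then show "derivable R Rs (fill u (SF (Join a b)))"
        using prov.joinL[of "CR (SF (bang_rules Rs)) u" R a _ b] by (simp add: derivable_def)
    qed
    show ?case
      by (rule covers_trans[OF 1]) (use Join in \<open>auto simp: covers_def\<close>)
  qed (simp_all only: alternatives.simps left)
qed

text \<open>A cut against \<open>prov_st_of\<close> folds a structure into the product formula that
  it spells out, the form in which the left side of a rule is matched.\<close>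

lemma covers_st_of: "covers R Rs {SF a} (st_of a)"
proof (rule coversI)
  fix u assume u: "wf_ctx u" "\<And>x. x \<in> {SF a} \<Longrightarrow> derivable R Rs (fill u x)"
  then show "derivable R Rs (fill u (st_of a))"
    using prov.cut[of "st_of a" "CR (SF (bang_rules Rs)) u" R a] prov_st_of is_k_bang_rules[of Rs]
    by (simp add: derivable_def is_k_def)
qed

text \<open>One rewrite step. From the conclusion upwards: contract the banged rules, move one copy
  next to \<open>l\<close>, strip its bang, select \<open>Ldiv l r\<close> from the meet, and fire
  it against \<open>l\<close>.\<close>

lemma covers_rule:
  assumes "(l, r) \<in> set Rs"
  shows "covers R Rs (alternatives r) (st_of l)"
proof -
  have "covers R Rs {SF r} (SF l)"
  proof (rule coversI)
    fix u assume u: "wf_ctx u" "\<And>x. x \<in> {SF r} \<Longrightarrow> derivable R Rs (fill u x)"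
    let ?k = "SF (bang_rules Rs)"
    have k: "is_k ?k" "wf_st ?k" using is_k_bang_rules by (auto simp: is_k_def)
    have "prov R (fill (CR ?k u) (SF r)) (Some goal)" using u(2) by (simp add: derivable_def)
    then have "prov R (fill (CR ?k u) (comp (SF l) (SF (Ldiv l r)))) (Some goal)"
      by (intro prov.ldivL) (auto simp: u k intro: prov.ax)
    then have "prov R (fill (plug (CR ?k u) (CR (SF l) Hole)) (SF (Ldiv l r))) (Some goal)" by simp
    \<comment> \<open>The single implication is hidden in the meet of all rules, and the meet under
      the bang.\<close>
    then have "prov R (fill (plug (CR ?k u) (CR (SF l) Hole)) ?k) (Some goal)"
      unfolding bang_rules_def using assms u(1) k
      by (intro prov.bangL prov_Meets[of "Ldiv l r"]) (force simp: bang_rules_def)+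
    then have "prov R (fill (CR ?k Hole) (fill u (comp (SF l) ?k))) (Some goal)" by simp
    then have "prov R (fill (CR ?k Hole) (comp ?k (fill u (SF l)))) (Some goal)"
      using prov_k_outwards[OF k(1) u(1), of "CR ?k Hole" "SF l"] k(2) by simp
    \<comment> \<open>The travelling copy meets the resident one; regrouping makes them a subtree
      \<open>k \<circ> k\<close> that \<open>kc\<close> can contract.\<close>
    then have "prov R (fill Hole (comp (comp ?k ?k) (fill u (SF l)))) (Some goal)"
      using prov.ka1b[OF k(1,2), of "fill u (SF l)" Hole] u(1) by simp
    then have "prov R (fill (CL Hole (fill u (SF l))) ?k) (Some goal)"
      using prov.kc[OF k(1), of "CL Hole (fill u (SF l))"] u(1) by simp
    then show "derivable R Rs (fill u (SF l))" by (simp add: derivable_def)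
  qed
  then show ?thesis
    using covers_st_of[of R Rs l] covers_alternatives[of R Rs r] by (metis covers_trans singletonD)
qed


text \<open>Further tallies are wrapped around the outside of the comb, whereas rules act on its
  deep end; so they are mere context.\<close>

lemma covers_reg:
  assumes "covers R Rs {reg i t' n' |t' n'. (t', n') \<in> T} (reg i t n)"
  shows "covers R Rs {reg i t' (n' + j) |t' n'. (t', n') \<in> T} (reg i t (n + j))"
proof (induction j)
  case (Suc j)
  have "(\<lambda>x. SC x (SF (tally i))) ` {reg i t' (n' + j) |t' n'. (t', n') \<in> T} =
      {reg i t' (n' + Suc j) |t' n'. (t', n') \<in> T}" by auto
  then show ?case using covers_SC(1)[OF Suc, of "SF (tally i)"] by auto
qed (use assms in auto)

lemma covers_cfg_state:
  assumes "covers R Rs ((\<lambda>s. SF (stt s)) ` T) (SF (stt s))"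
  shows "covers R Rs ((\<lambda>s. cfg s f rs) ` T) (cfg s f rs)"
proof (induction rs)
  case (Cons r rs)
  have "SE \<notin> (\<lambda>s. cfg s f rs) ` T" by auto
  then show ?case using covers_SC(1)[OF Cons, of "reg r (fst (f r)) (snd (f r))"]
    by (simp add: image_image)
qed (use assms in simp)

lemma covers_cfg_reg:
  assumes "covers R Rs {reg i t' n' |t' n'. (t', n') \<in> T} (reg i t n)" "distinct rs" "i \<in> set rs"
  shows "covers R Rs ((\<lambda>p. cfg s (f(i := p)) rs) ` T) (cfg s (f(i := (t, n))) rs)"
  using assms(2,3)
proof (induction rs)
  case (Cons r rs)
  have upd: "cfg s (f(i := p)) rs = cfg s f rs" if "i \<notin> set rs" for p
    using that by (induction rs) auto
  show ?case
  proof (cases "i = r")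
    case True
    have "{reg i t' n' |t' n'. (t', n') \<in> T} = (\<lambda>p. reg i (fst p) (snd p)) ` T" by force
    moreover have "SE \<notin> (\<lambda>p. reg i (fst p) (snd p)) ` T" by auto
    ultimately show ?thesis using covers_SC(2)[OF assms(1), of "cfg s f rs"] True Cons.prems upd
      by (simp add: image_image fun_upd_same del: fun_upd_apply)
  next
    case False
    have "SE \<notin> (\<lambda>p. cfg s (f(i := p)) rs) ` T" by auto
    then show ?thesis
      using covers_SC(1)[OF Cons.IH, of "reg r (fst (f r)) (snd (f r))"] Cons.prems False
      by (simp add: image_image fun_upd_other del: fun_upd_apply)
  qed
qed simp

lemma covers_cfg_pointwise:
  assumes "\<And>i. i \<in> set rs \<Longrightarrow>
    covers R Rs {reg i (fst (g i)) (snd (g i))} (reg i (fst (f i)) (snd (f i)))"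
  shows "covers R Rs {cfg s g rs} (cfg s f rs)"
  using assms
proof (induction rs)
  case (Cons r rs)
  let ?f = "reg r (fst (f r)) (snd (f r))" and ?g = "reg r (fst (g r)) (snd (g r))"
  have "covers R Rs {SC (cfg s g rs) ?f} (SC (cfg s f rs) ?f)"
    using covers_SC(1)[of R Rs "{cfg s g rs}" "cfg s f rs" ?f] Cons by simp
  moreover have "covers R Rs {SC (cfg s g rs) ?g} (SC (cfg s g rs) ?f)"
    using covers_SC(2)[of R Rs "{?g}" ?f "cfg s g rs"] Cons.prems[of r] by simp
  ultimately show ?case by (metis cfg.simps(2) covers_trans singletonD)
qed (auto intro: covers_refl)

lemma covers_absorb:
  assumes "(Prod (rgt i t) (tally i), rgt i t) \<in> set Rs"
  shows "covers R Rs {reg i t 0} (reg i t n)"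
proof (induction n)
  case (Suc n)
  have "covers R Rs {reg i t 0} (reg i t 1)" using covers_rule[OF assms, of R] by simp
  then have "covers R Rs {reg i t n} (reg i t (Suc n))"
    using covers_reg[of R Rs i "{(t, 0)}" t 1 n] by simp
  then show ?case using Suc by (metis covers_trans singletonD)
qed (simp add: covers_refl)

text \<open>Here a branch of the simulation ends: weakening discards the banged rules and an axiom
  remains.\<close>

lemma derivable_goal: "derivable R Rs (SF goal)"
proof -
  have k: "is_k (SF (bang_rules Rs))" by (rule is_k_bang_rules)
  have "prov R (fill (CL Hole (SF goal)) (SF (bang_rules Rs))) (Some goal)"
    by (rule prov.kw[OF k]) (auto intro: prov.ax)
  then show ?thesis by (simp add: derivable_def)
qed

lemma derivable_pattern:
  assumes "(pattern s g rs, goal) \<in> set Rs"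
    and "\<And>i. i \<in> set rs \<Longrightarrow> covers R Rs {reg i (g i) 0} (reg i (fst (f i)) (snd (f i)))"
  shows "derivable R Rs (cfg s f rs)"
proof -
  have "covers R Rs {SF goal} (cfg s (\<lambda>i. (g i, 0)) rs)"
    using covers_rule[OF assms(1)] by (simp add: st_of_pattern)
  then have "derivable R Rs (cfg s (\<lambda>i. (g i, 0)) rs)"
    by (rule coversD) (use derivable_goal in auto)
  moreover have "covers R Rs {cfg s (\<lambda>i. (g i, 0)) rs} (cfg s f rs)"
    by (rule covers_cfg_pointwise) (use assms(2) in simp)
  ultimately show ?thesis by (auto intro: coversD)
qed

lemma rules_instr: "I \<in> set Is \<Longrightarrow> set (instr_rules k I) \<subseteq> set (rules k Is)"
  by (auto simp: rules_def)

lemma rules_register: "i < k \<Longrightarrow> set (register_rules k i) \<subseteq> set (rules k Is)"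
  by (auto simp: rules_def)

section \<open>Replaying an accepting run as a derivation\<close>

context
  fixes R :: "srule set" and k :: nat and Is :: "instr list" and Rs
  defines "Rs \<equiv> rules k Is"
begin

lemma covers_erase:
  assumes "i < k"
  shows "covers R Rs {reg i IdleX 0} (reg i Idle n)" "covers R Rs {reg i DoneX 0} (reg i Done n)"
proof -
  have "set (register_rules k i) \<subseteq> set Rs" unfolding Rs_def using assms by (rule rules_register)
  then have r: "(rgt i Idle, rgt i IdleX) \<in> set Rs" "(rgt i Done, rgt i DoneX) \<in> set Rs"
    and a: "(Prod (rgt i IdleX) (tally i), rgt i IdleX) \<in> set Rs"
      "(Prod (rgt i DoneX) (tally i), rgt i DoneX) \<in> set Rs"
    by (auto simp: register_rules_def)
  have "covers R Rs {reg i IdleX n} (reg i Idle n)"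
    using covers_rule[OF r(1)] covers_reg[of R Rs i "{(IdleX, 0)}" Idle 0 n] by simp
  then show "covers R Rs {reg i IdleX 0} (reg i Idle n)"
    using covers_absorb[OF a(1)] by (metis covers_trans singletonD)
  have "covers R Rs {reg i DoneX n} (reg i Done n)"
    using covers_rule[OF r(2)] covers_reg[of R Rs i "{(DoneX, 0)}" Done 0 n] by simp
  then show "covers R Rs {reg i DoneX 0} (reg i Done n)"
    using covers_absorb[OF a(2)] by (metis covers_trans singletonD)
qed

lemma derivable_AskIdle: "derivable R Rs (cfg AskIdle (\<lambda>i. (Idle, v i)) [0..<k])"
  by (rule derivable_pattern[where g = "\<lambda>_. IdleX"]) (auto simp: Rs_def rules_def covers_erase[simplified, unfolded Rs_def rules_def])

lemma derivable_AskDone: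
  assumes "i < k"
  shows "derivable R Rs (cfg (AskDone i) ((\<lambda>j. (Idle, v j))(i := (Done, n))) [0..<k])"
  by (rule derivable_pattern[where g = "(\<lambda>_. IdleX)(i := DoneX)"])
    (use rules_register[OF assms, of Is] in \<open>auto simp: Rs_def[symmetric] register_rules_def covers_erase[simplified]\<close>)

lemma derivable_Query:
  assumes "i < k" "set (query_rules k i s) \<subseteq> set Rs"
  shows "derivable R Rs (cfg s ((\<lambda>j. (Idle, v j))(i := (Query s, n))) [0..<k])"
  by (rule derivable_pattern[where g = "(\<lambda>_. IdleX)(i := Query s)"])
    (use assms in \<open>auto simp: covers_erase[simplified] covers_absorb[simplified]\<close>)

text \<open>A register move produces a query branch, which \<open>derivable_Query\<close> closes
  whatever the number \<open>m'\<close> of tallies there. Only the branch of the intended move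
  remains; \<open>l\<close> counts the tallies not touched by it.\<close>

lemma derivable_register_move:
  assumes "i < k" "set (query_rules k i s) \<subseteq> set Rs"
    and "covers R Rs {reg i t' n', reg i (Query s) m'} (reg i t n)"
    and "derivable R Rs (cfg s ((\<lambda>j. (Idle, v j))(i := (t', n' + l))) [0..<k])"
  shows "derivable R Rs (cfg s ((\<lambda>j. (Idle, v j))(i := (t, n + l))) [0..<k])"
proof -
  have "{reg i t' n', reg i (Query s) m'} = {reg i u h |u h. (u, h) \<in> {(t', n'), (Query s, m')}}"
    by auto
  then have "covers R Rs {reg i u h |u h. (u, h) \<in> {(t', n'), (Query s, m')}} (reg i t n)"
    using assms(3) by simp
  then have "covers R Rs {reg i u (h + l) |u h. (u, h) \<in> {(t', n'), (Query s, m')}} (reg i t (n + l))"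
    by (rule covers_reg)
  moreover have "{reg i u (h + l) |u h. (u, h) \<in> {(t', n'), (Query s, m')}} =
    {reg i u h |u h. (u, h) \<in> {(t', n' + l), (Query s, m' + l)}}" by auto
  ultimately have "covers R Rs
      ((\<lambda>p. cfg s ((\<lambda>j. (Idle, v j))(i := p)) [0..<k]) ` {(t', n' + l), (Query s, m' + l)})
      (cfg s ((\<lambda>j. (Idle, v j))(i := (t, n + l))) [0..<k])"
    using assms(1) by (intro covers_cfg_reg) auto
  then show ?thesis
    by (rule coversD) (use assms(4) derivable_Query[OF assms(1,2)] in \<open>auto simp del: query_rules.simps\<close>)
qed

lemma derivable_state_move:
  assumes "covers R Rs ((\<lambda>s. SF (stt s)) ` T) (SF (stt s))"
    and "\<And>s'. s' \<in> T \<Longrightarrow> derivable R Rs (cfg s' f [0..<k])"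
  shows "derivable R Rs (cfg s f [0..<k])"
  by (rule coversD[OF covers_cfg_state[OF assms(1)]]) (use assms(2) in auto)

lemma idle_upd: "(\<lambda>j. (Idle, v j))(i := (Idle, n)) = (\<lambda>j. (Idle, (v(i := n)) j))"
  by auto

text \<open>Induction over the run: derivability passes from the successor configurations to the
  predecessor, each check branch being closed on the spot because all idle registers are in
  order.\<close>

lemma derivable_if_acc:
  assumes "acc (set Is) q v"
    and regs: "\<And>q i. Havoc q i \<in> set Is \<Longrightarrow> i < k" "\<And>q i q'. Dec q i q' \<in> set Is \<Longrightarrow> i < k"
  shows "derivable R Rs (cfg (State q) (\<lambda>i. (Idle, v i)) [0..<k])"
  using assms(1)
proof (induction rule: acc.induct)
  case (fork q q1 q2 v)
  have "set (instr_rules k (Fork q q1 q2)) \<subseteq> set Rs"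
    unfolding Rs_def using fork(1) by (rule rules_instr)
  then have "covers R Rs ((\<lambda>s. SF (stt s)) ` {State q1, State q2, AskIdle}) (SF (stt (State q)))"
    using covers_rule[of "stt (State q)" "Join (stt (State q1)) (Join (stt (State q2)) (stt AskIdle))" Rs R]
    by (simp add: insert_commute)
  then show ?case
    by (rule derivable_state_move) (use fork derivable_AskIdle in auto)
next
  case (havoc q i v n)
  have i: "i < k" using regs(1) havoc(1) .
  have rules: "set (instr_rules k (Havoc q i)) \<subseteq> set Rs"
    unfolding Rs_def using havoc(1) by (rule rules_instr)
  then have query: "set (query_rules k i (State q)) \<subseteq> set Rs" by simp
  let ?D = "\<lambda>n. derivable R Rs (cfg (State q) ((\<lambda>j. (Idle, v j))(i := (Idle, n))) [0..<k])"
  have "covers R Rs {reg i Idle 1, reg i (Query (State q)) 0} (reg i Idle 0)"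
    using covers_rule[of "rgt i Idle" "Join (Prod (rgt i Idle) (tally i)) (rgt i (Query (State q)))" Rs R]
      rules by (simp add: insert_commute)
  from derivable_register_move[OF i query this, of v] have down: "?D (Suc m) \<Longrightarrow> ?D m" for m
    by simp
  have "covers R Rs {reg i Idle 0, reg i (Query (State q)) 0} (reg i Idle 1)"
    using covers_rule[of "Prod (rgt i Idle) (tally i)" "Join (rgt i Idle) (rgt i (Query (State q)))" Rs R]
      rules by (simp add: insert_commute)
  from derivable_register_move[OF i query this, of v] have up: "?D m \<Longrightarrow> ?D (Suc m)" for m
    by simp
  have "?D n" using havoc.IH by (simp only: idle_upd)
  \<comment> \<open>The guessed value \<open>n\<close> and the actual value \<open>v i\<close> are
    linked through 0, by single tallies.\<close>
  then have "?D 0" by (induction n) (auto intro: down simp del: fun_upd_apply)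
  then have "?D m" for m by (induction m) (auto intro: up simp del: fun_upd_apply)
  from this[of "v i"] show ?case unfolding idle_upd by simp
next
  case (dec q i q' v n)
  have i: "i < k" using regs(2) dec(1) .
  have rules: "set (instr_rules k (Dec q i q')) \<subseteq> set Rs"
    unfolding Rs_def using dec(1) by (rule rules_instr)
  then have query: "set (query_rules k i (State q)) \<subseteq> set Rs" "set (query_rules k i (Mid i q')) \<subseteq> set Rs"
    by simp_all
  let ?D = "\<lambda>s t n. derivable R Rs (cfg s ((\<lambda>j. (Idle, v j))(i := (t, n))) [0..<k])"
  \<comment> \<open>The handshake is followed from its last step back to its first.\<close>
  have 0: "?D (State q') Idle n" using dec.IH by (simp only: idle_upd)
  have "covers R Rs ((\<lambda>s. SF (stt s)) ` {State q', AskIdle}) (SF (stt (Mid i q')))"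
    using covers_rule[of "stt (Mid i q')" "Join (stt (State q')) (stt AskIdle)" Rs R] rules
    by (simp add: insert_commute)
  then have 1: "?D (Mid i q') Idle n"
    by (rule derivable_state_move) (use 0 derivable_AskIdle in \<open>auto simp only: idle_upd\<close>)
  have "covers R Rs {reg i Idle 0, reg i (Query (Mid i q')) 0} (reg i Done 0)"
    using covers_rule[of "rgt i Done" "Join (rgt i Idle) (rgt i (Query (Mid i q')))" Rs R] rules
    by (simp add: insert_commute)
  from derivable_register_move[OF i query(2) this, of v n] 1 have 2: "?D (Mid i q') Done n" by simp
  have "covers R Rs ((\<lambda>s. SF (stt s)) ` {Mid i q', AskDone i}) (SF (stt (State q)))"
    using covers_rule[of "stt (State q)" "Join (stt (Mid i q')) (stt (AskDone i))" Rs R] rules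
    by (simp add: insert_commute)
  then have 3: "?D (State q) Done n"
    by (rule derivable_state_move) (use 2 derivable_AskDone[OF i] in auto)
  have "covers R Rs {reg i Done 0, reg i (Query (State q)) 0} (reg i Idle 1)"
    using covers_rule[of "Prod (rgt i Idle) (tally i)" "Join (rgt i Done) (rgt i (Query (State q)))" Rs R]
      rules by (simp add: insert_commute)
  from derivable_register_move[OF i query(1) this, of v n] 3 have "?D (State q) Idle (Suc n)" by simp
  then show ?case unfolding idle_upd using dec(2) by (metis fun_upd_triv)
next
  case (zero q i v)
  have "set (instr_rules k (Zero q i)) \<subseteq> set Rs"
    unfolding Rs_def using zero(1) by (rule rules_instr)
  then show ?case
    by (intro derivable_pattern[where g = "(\<lambda>_. IdleX)(i := Idle)"])
      (use zero(2) in \<open>auto simp: covers_erase[simplified] covers_refl\<close>)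
qed

end

section \<open>Phase semantics\<close>

locale phase_space =
  fixes mult :: "'g \<Rightarrow> 'g \<Rightarrow> 'g" (infixl "\<odot>" 70) and unit null :: 'g and pole :: "'g set"
    and val :: "nat \<Rightarrow> 'g set"
  assumes mult_comm: "x \<odot> y = y \<odot> x"
    and mult_unit [simp]: "unit \<odot> x = x"
    and mult_null [simp]: "null \<odot> x = null"
    and null_pole: "null \<notin> pole"
    and mult_self: "x \<odot> x = null \<or> x = unit"
begin

section \<open>Closure operator and set product\<close>

lemma mult_unit_right [simp]: "x \<odot> unit = x" and mult_null_right [simp]: "x \<odot> null = null"
  by (simp_all add: mult_comm[of x])

text \<open>The biorthogonal closure with respect to \<open>pole\<close>. By commutativity a
  sequence of right multiplications is the general form of a context, so the tests are lists; they
  are kept as lists because the product need not be associative.\<close>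

definition cl :: "'g set \<Rightarrow> 'g set" where
  "cl X = {y. \<forall>gs. (\<forall>x\<in>X. foldl (\<odot>) x gs \<in> pole) \<longrightarrow> foldl (\<odot>) y gs \<in> pole}"

definition smult :: "'g set \<Rightarrow> 'g set \<Rightarrow> 'g set" (infixl "\<otimes>" 70) where
  "X \<otimes> Y = {x \<odot> y |x y. x \<in> X \<and> y \<in> Y}"

lemma cl_increasing: "X \<subseteq> cl X"
  by (auto simp: cl_def)

lemma cl_mono: "X \<subseteq> Y \<Longrightarrow> cl X \<subseteq> cl Y"
  by (auto simp: cl_def)

lemma cl_least: "X \<subseteq> cl Y \<Longrightarrow> cl X \<subseteq> cl Y"
  unfolding cl_def by blast

lemma cl_idem [simp]: "cl (cl X) = cl X"
  using cl_least[of "cl X" X] cl_increasing[of "cl X"] by blast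

lemma cl_pole [simp]: "cl pole = pole"
proof -
  have "y \<in> pole" if "y \<in> cl pole" for y
    using that unfolding cl_def by (force dest: spec[of _ "[]"])
  then show ?thesis using cl_increasing[of pole] by blast
qed

lemma smultI: "x \<in> X \<Longrightarrow> y \<in> Y \<Longrightarrow> x \<odot> y \<in> X \<otimes> Y"
  unfolding smult_def by blast

lemma smult_comm: "X \<otimes> Y = Y \<otimes> X"
  unfolding smult_def using mult_comm by blast

lemma smult_unit [simp]: "{unit} \<otimes> X = X" "X \<otimes> {unit} = X"
  by (auto simp: smult_def)

lemma smult_empty [simp]: "{} \<otimes> X = {}" "X \<otimes> {} = {}"
  by (auto simp: smult_def)

lemma smult_mono: "X \<subseteq> X' \<Longrightarrow> Y \<subseteq> Y' \<Longrightarrow> X \<otimes> Y \<subseteq> X' \<otimes> Y'"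
  unfolding smult_def by blast

lemma smult_Un: "(X \<union> X') \<otimes> Y = X \<otimes> Y \<union> X' \<otimes> Y" "Y \<otimes> (X \<union> X') = Y \<otimes> X \<union> Y \<otimes> X'"
  unfolding smult_def by blast+

text \<open>A test \<open>gs\<close> applied to a product with \<open>y\<close> is the test
  \<open>y # gs\<close> applied to the other factor. This makes \<open>cl\<close> a nucleus.\<close>

lemma cl_smult: "cl X \<otimes> Y \<subseteq> cl (X \<otimes> Y)"
proof
  fix w assume "w \<in> cl X \<otimes> Y"
  then obtain x y where w: "w = x \<odot> y" "x \<in> cl X" "y \<in> Y" by (auto simp: smult_def)
  have "foldl (\<odot>) w gs \<in> pole" if "\<forall>v\<in>X \<otimes> Y. foldl (\<odot>) v gs \<in> pole" for gs
  proof -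
    have "foldl (\<odot>) x' (y # gs) \<in> pole" if "x' \<in> X" for x'
      using \<open>\<forall>v\<in>X \<otimes> Y. _ v\<close> that w(3) by (auto simp: smult_def)
    then have "foldl (\<odot>) x (y # gs) \<in> pole" using w(2) unfolding cl_def by blast
    then show ?thesis by (simp add: w(1))
  qed
  then show "w \<in> cl (X \<otimes> Y)" by (simp add: cl_def)
qed

lemma cl_smult_right: "Y \<otimes> cl X \<subseteq> cl (Y \<otimes> X)"
  using cl_smult[of X Y] by (simp add: smult_comm)

lemma cl_smult_cl: "cl (cl X \<otimes> cl Y) = cl (X \<otimes> Y)"
proof
  have "cl X \<otimes> cl Y \<subseteq> cl (cl X \<otimes> Y)" by (rule cl_smult_right)
  also have "\<dots> \<subseteq> cl (X \<otimes> Y)" by (rule cl_least[OF cl_smult])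
  finally show "cl (cl X \<otimes> cl Y) \<subseteq> cl (X \<otimes> Y)" by (rule cl_least)
  show "cl (X \<otimes> Y) \<subseteq> cl (cl X \<otimes> cl Y)"
    by (intro cl_mono smult_mono cl_increasing)
qed

text \<open>A banged formula is equivalent to the unit or to the bottom \<open>cl {}\<close>, the
  two values that commute, associate and contract even though the groupoid is not associative.
  \<open>FZero\<close> and the empty stoup are bottom, which validates rule
  \<open>o\<close>.\<close>

fun sem :: "fm \<Rightarrow> 'g set" where
  "sem (FVar n) = cl (val n)"
| "sem (Meet a b) = sem a \<inter> sem b"
| "sem (Join a b) = cl (sem a \<union> sem b)"
| "sem (Prod a b) = cl (sem a \<otimes> sem b)"
| "sem (Ldiv a b) = {z. \<forall>x\<in>sem a. x \<odot> z \<in> sem b}"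
| "sem (Rdiv b a) = {z. \<forall>x\<in>sem a. z \<odot> x \<in> sem b}"
| "sem (Bang a) = cl (if unit \<in> sem a then {unit} else {})"
| "sem FOne = cl {unit}"
| "sem FZero = cl {}"

fun sem_st :: "st \<Rightarrow> 'g set" where
  "sem_st SE = {unit}"
| "sem_st (SF a) = sem a"
| "sem_st (SC x y) = sem_st x \<otimes> sem_st y"

fun sem_stoup :: "fm option \<Rightarrow> 'g set" where
  "sem_stoup None = cl {}"
| "sem_stoup (Some a) = sem a"

fun sem_ctx :: "ctx \<Rightarrow> 'g set \<Rightarrow> 'g set" where
  "sem_ctx Hole X = X"
| "sem_ctx (CL u y) X = sem_ctx u X \<otimes> sem_st y"
| "sem_ctx (CR y u) X = sem_st y \<otimes> sem_ctx u X"

lemma sem_comp [simp]: "sem_st (comp x y) = sem_st x \<otimes> sem_st y"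
  by (simp add: comp_def)

lemma sem_fill [simp]: "sem_st (fill u x) = sem_ctx u (sem_st x)"
  by (induction u) auto

lemma sem_ctx_mono: "X \<subseteq> Y \<Longrightarrow> sem_ctx u X \<subseteq> sem_ctx u Y"
  by (induction u) (auto intro!: smult_mono del: subsetI)

lemma sem_ctx_Un: "sem_ctx u (X \<union> Y) = sem_ctx u X \<union> sem_ctx u Y"
  by (induction u) (auto simp: smult_Un)

lemma sem_ctx_cl: "sem_ctx u (cl X) \<subseteq> cl (sem_ctx u X)"
proof (induction u)
  case (CL u y)
  have "sem_ctx u (cl X) \<otimes> sem_st y \<subseteq> cl (sem_ctx u X) \<otimes> sem_st y"
    using CL by (intro smult_mono) auto
  then show ?case using cl_smult by fastforce
next
  case (CR y u)
  have "sem_st y \<otimes> sem_ctx u (cl X) \<subseteq> sem_st y \<otimes> cl (sem_ctx u X)"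
    using CR by (intro smult_mono) auto
  then show ?case using cl_smult_right by fastforce
qed simp

lemma cl_sem: "cl (sem a) = sem a"
proof (induction a)
  case (Meet a b)
  have "cl (sem a \<inter> sem b) \<subseteq> cl (sem a) \<inter> cl (sem b)" using cl_mono by (metis inf_le1 inf_le2 le_inf_iff)
  then show ?case using Meet cl_increasing[of "sem a \<inter> sem b"] by auto
next
  case (Ldiv a b)
  have "z \<in> sem (Ldiv a b)" if "z \<in> cl (sem (Ldiv a b))" for z
  proof -
    have "x \<odot> z \<in> sem b" if "x \<in> sem a" for x
    proof -
      have "x \<odot> z \<in> {x} \<otimes> cl (sem (Ldiv a b))" using \<open>z \<in> _\<close> by (auto simp: smult_def)
      also have "\<dots> \<subseteq> cl ({x} \<otimes> sem (Ldiv a b))" by (rule cl_smult_right)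
      also have "\<dots> \<subseteq> cl (sem b)" using that by (intro cl_mono) (auto simp: smult_def)
      finally show ?thesis using Ldiv by simp
    qed
    then show ?thesis by simp
  qed
  then show ?case using cl_increasing by blast
next
  case (Rdiv b a)
  have "z \<in> sem (Rdiv b a)" if "z \<in> cl (sem (Rdiv b a))" for z
  proof -
    have "z \<odot> x \<in> sem b" if "x \<in> sem a" for x
    proof -
      have "z \<odot> x \<in> cl (sem (Rdiv b a)) \<otimes> {x}" using \<open>z \<in> _\<close> by (auto simp: smult_def)
      also have "\<dots> \<subseteq> cl (sem (Rdiv b a) \<otimes> {x})" by (rule cl_smult)
      also have "\<dots> \<subseteq> cl (sem b)" using that by (intro cl_mono) (auto simp: smult_def)
      finally show ?thesis using Rdiv by simp
    qed
    then show ?thesis by simp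
  qed
  then show ?case using cl_increasing by blast
qed simp_all

lemma cl_sem_stoup: "cl (sem_stoup d) = sem_stoup d"
  by (cases d) (simp_all add: cl_sem)

lemma cl_empty_subset: "cl {} \<subseteq> sem_stoup d"
  using cl_mono[of "{}" "sem_stoup d"] cl_sem_stoup by auto

text \<open>The common core of the left and structural rules: inside a context a set may be replaced
  by anything in the closure of its replacement.\<close>

lemma sem_ctx_left:
  assumes "X \<subseteq> cl Y" "sem_ctx u Y \<subseteq> sem_stoup d"
  shows "sem_ctx u X \<subseteq> sem_stoup d"
proof -
  have "sem_ctx u X \<subseteq> cl (sem_ctx u Y)" using sem_ctx_mono[OF assms(1), of u] sem_ctx_cl by blast
  also have "\<dots> \<subseteq> cl (sem_stoup d)" by (rule cl_mono[OF assms(2)])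
  finally show ?thesis by (simp add: cl_sem_stoup)
qed

text \<open>The dichotomy between bottom and unit passes to compositions: bottom absorbs every
  product, and the closure of the unit is closed under products.\<close>

lemma sem_bang_only:
  assumes "bang_only k"
  shows "sem_st k \<subseteq> cl {} \<or> (unit \<in> sem_st k \<and> sem_st k \<subseteq> cl {unit})"
  using assms
proof (induction k)
  case SE
  then show ?case using cl_increasing[of "{unit}"] by auto
next
  case (SF a)
  then obtain b where "a = Bang b" by auto
  then show ?case using cl_increasing[of "{unit}"] by (cases "unit \<in> sem b") auto
next
  case (SC x y)
  have bot: "X \<otimes> Y \<subseteq> cl {}" if "X \<subseteq> cl {} \<or> Y \<subseteq> cl {}" for X Y
    using that smult_mono[of X "cl {}" Y Y] smult_mono[of X X Y "cl {}"]
      cl_smult[of "{}" Y] cl_smult_right[of X "{}"] by auto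
  show ?case
  proof (cases "sem_st x \<subseteq> cl {} \<or> sem_st y \<subseteq> cl {}")
    case True
    then show ?thesis using bot by auto
  next
    case False
    then have *: "unit \<in> sem_st x" "sem_st x \<subseteq> cl {unit}" "unit \<in> sem_st y" "sem_st y \<subseteq> cl {unit}"
      using SC by auto
    have "sem_st x \<otimes> sem_st y \<subseteq> cl {unit} \<otimes> cl {unit}" using * by (intro smult_mono)
    also have "\<dots> \<subseteq> cl (cl {unit} \<otimes> cl {unit})" by (rule cl_increasing)
    also have "\<dots> = cl {unit}" by (simp add: cl_smult_cl)
    finally have "sem_st x \<otimes> sem_st y \<subseteq> cl {unit}" .
    moreover have "unit \<odot> unit \<in> sem_st x \<otimes> sem_st y" using * unfolding smult_def by blast
    ultimately show ?thesis by simp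
  qed
qed

lemma sem_k:
  assumes "is_k k"
  obtains "sem_st k \<subseteq> cl {}" "\<And>Y. sem_st k \<otimes> Y \<subseteq> cl {}" "\<And>Y. Y \<otimes> sem_st k \<subseteq> cl {}"
  | "unit \<in> sem_st k" "sem_st k \<subseteq> cl {unit}"
    "\<And>Y. Y \<subseteq> sem_st k \<otimes> Y" "\<And>Y. sem_st k \<otimes> Y \<subseteq> cl Y" "\<And>Y. Y \<otimes> sem_st k \<subseteq> cl Y"
proof -
  from assms have "bang_only k" by (simp add: is_k_def)
  from sem_bang_only[OF this] show thesis
  proof
    assume *: "sem_st k \<subseteq> cl {}"
    have 1: "sem_st k \<otimes> Y \<subseteq> cl {}" for Y
      using smult_mono[OF *, of Y Y] cl_smult[of "{}" Y] by auto
    show thesis using that(1)[OF * 1] 1 by (simp add: smult_comm)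
  next
    assume *: "unit \<in> sem_st k \<and> sem_st k \<subseteq> cl {unit}"
    have 1: "Y \<subseteq> sem_st k \<otimes> Y" for Y
      using smult_mono[of "{unit}" "sem_st k" Y Y] * by auto
    have 2: "sem_st k \<otimes> Y \<subseteq> cl Y" for Y
      using smult_mono[of "sem_st k" "cl {unit}" Y Y] cl_smult[of "{unit}" Y] * by auto
    show thesis using that(2)[OF _ _ 1 2] * 2 by (simp add: smult_comm)
  qed
qed

text \<open>No associativity of the product is involved. Either both sides lie in bottom, or both
  have the closure of \<open>Y \<otimes> Z\<close>.\<close>

lemma sem_k_assoc:
  assumes "is_k k"
  shows "sem_st k \<otimes> (Y \<otimes> Z) \<subseteq> cl ((sem_st k \<otimes> Y) \<otimes> Z)"
    and "(sem_st k \<otimes> Y) \<otimes> Z \<subseteq> cl (sem_st k \<otimes> (Y \<otimes> Z))"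
proof -
  let ?K = "sem_st k"
  have "?K \<otimes> (Y \<otimes> Z) \<subseteq> cl ((?K \<otimes> Y) \<otimes> Z) \<and> (?K \<otimes> Y) \<otimes> Z \<subseteq> cl (?K \<otimes> (Y \<otimes> Z))"
    using assms
  proof (cases rule: sem_k)
    case 1
    have "(?K \<otimes> Y) \<otimes> Z \<subseteq> cl {} \<otimes> Z" using 1 by (intro smult_mono) auto
    also have "\<dots> \<subseteq> cl ({} \<otimes> Z)" by (rule cl_smult)
    finally show ?thesis using 1(2)[of "Y \<otimes> Z"] cl_mono[of "{}"] by auto
  next
    case 2
    have "Y \<otimes> Z \<subseteq> (?K \<otimes> Y) \<otimes> Z" using 2 by (intro smult_mono) auto
    then have a: "cl (Y \<otimes> Z) \<subseteq> cl ((?K \<otimes> Y) \<otimes> Z)" by (rule cl_mono)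
    have "(?K \<otimes> Y) \<otimes> Z \<subseteq> cl Y \<otimes> Z" using 2 by (intro smult_mono) auto
    also have "\<dots> \<subseteq> cl (Y \<otimes> Z)" by (rule cl_smult)
    also have "\<dots> \<subseteq> cl (?K \<otimes> (Y \<otimes> Z))" using 2(3) by (rule cl_mono)
    finally show ?thesis using a 2(4)[of "Y \<otimes> Z"] by blast
  qed
  then show "?K \<otimes> (Y \<otimes> Z) \<subseteq> cl ((?K \<otimes> Y) \<otimes> Z)"
    and "(?K \<otimes> Y) \<otimes> Z \<subseteq> cl (?K \<otimes> (Y \<otimes> Z))" by auto
qed

text \<open>The rule set is arbitrary: commutativity validates \<open>e\<close>,
  \<open>mult_self\<close> validates \<open>c\<close>, and bottom being least validates
  \<open>o\<close>. One model thus serves every choice of rules.\<close>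

theorem soundness:
  assumes "prov R x d"
  shows "sem_st x \<subseteq> sem_stoup d"
  using assms
proof induction
  case (oneR)
  then show ?case using cl_increasing by simp
next
  case (cut x u a d)
  then show ?case by (auto simp: cl_sem intro!: sem_ctx_left[of "sem_st x" "sem a" u d] del: subsetI)
next
  case (oneL u d)
  then show ?case by (auto intro!: sem_ctx_left[of "cl {unit}" "{unit}" u d] del: subsetI)
next
  case (ldivL x u a b d)
  have "sem_st x \<otimes> sem (Ldiv a b) \<subseteq> cl (sem b)" using ldivL by (auto simp: smult_def cl_sem)
  then show ?case using sem_ctx_left[of _ "sem b" u d] ldivL by simp
next
  case (ldivR x a b)
  then show ?case by (force simp: smult_def)
next
  case (rdivL x u a b d)
  have "sem (Rdiv b a) \<otimes> sem_st x \<subseteq> cl (sem b)" using rdivL by (auto simp: smult_def cl_sem)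
  then show ?case using sem_ctx_left[of _ "sem b" u d] rdivL by simp
next
  case (rdivR x a b)
  then show ?case by (force simp: smult_def)
next
  case (prodL u a b d)
  then show ?case using sem_ctx_left[of "cl (sem a \<otimes> sem b)" "sem a \<otimes> sem b" u d] by simp
next
  case (prodR x y a b)
  then show ?case using smult_mono[of "sem_st x" "sem a" "sem_st y" "sem b"] cl_increasing by fastforce
next
  case (meetL1 u a d b)
  have "sem a \<inter> sem b \<subseteq> cl (sem a)" by (simp add: cl_sem)
  then show ?case using sem_ctx_left[of _ "sem a" u d] meetL1 by simp
next
  case (meetL2 u b d a)
  have "sem a \<inter> sem b \<subseteq> cl (sem b)" by (simp add: cl_sem)
  then show ?case using sem_ctx_left[of _ "sem b" u d] meetL2 by simp
next
  case (joinL u a d b)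
  then show ?case using sem_ctx_left[of "cl (sem a \<union> sem b)" "sem a \<union> sem b" u d]
    by (simp add: sem_ctx_Un)
next
  case (joinR1 x a b)
  then show ?case using cl_increasing[of "sem a \<union> sem b"] by auto
next
  case (joinR2 x b a)
  then show ?case using cl_increasing[of "sem a \<union> sem b"] by auto
next
  case (bangL u a d)
  have "sem (Bang a) \<subseteq> cl (sem a)" using cl_mono[of "{unit}" "sem a"] cl_mono[of "{}" "sem a"] by auto
  then show ?case using sem_ctx_left[of _ "sem a" u d] bangL by simp
next
  case (bangR k a)
  then show ?case using cl_mono[of "{}" "{unit}"] by (cases rule: sem_k[OF bangR(1)]) auto
next
  case (kw k u d)
  have "sem_st k \<subseteq> cl {unit}"
    using cl_mono[of "{}" "{unit}"] by (cases rule: sem_k[OF kw(1)]) auto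
  then show ?case using sem_ctx_left[of _ "{unit}" u d] kw by simp
next
  case (kc k u d)
  have "sem_st k \<subseteq> cl (sem_st k \<otimes> sem_st k)"
  proof (cases rule: sem_k[OF kc(1)])
    case 1
    then show ?thesis using cl_mono[of "{}" "sem_st k \<otimes> sem_st k"] by blast
  next
    case 2
    then show ?thesis using cl_increasing by blast
  qed
  then show ?case using sem_ctx_left[of _ "sem_st k \<otimes> sem_st k" u d] kc by simp
next
  case (ke1 k y u d)
  then show ?case by (simp add: smult_comm)
next
  case (ke2 k y u d)
  then show ?case by (simp add: smult_comm)
next
  case (ka1a k y z u d)
  then show ?case using sem_ctx_left[OF sem_k_assoc(1)[OF ka1a(1)], of u] by simp
next
  case (ka1b k y z u d)
  then show ?case using sem_ctx_left[OF sem_k_assoc(2)[OF ka1b(1)], of u] by simp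
next
  case (ka2a k x y u d)
  then show ?case
    using sem_ctx_left[OF sem_k_assoc(2)[OF ka2a(1), of "sem_st y" "sem_st x"], of u d]
    by (simp add: smult_comm)
next
  case (ka2b k x y u d)
  then show ?case
    using sem_ctx_left[OF sem_k_assoc(1)[OF ka2b(1), of "sem_st y" "sem_st x"], of u d]
    by (simp add: smult_comm)
next
  case (ruleE x y u d)
  then show ?case by (simp add: smult_comm)
next
  case (ruleC x u d)
  have "sem_st x \<subseteq> cl (sem_st x \<otimes> sem_st x)"
  proof
    fix g assume g: "g \<in> sem_st x"
    have *: "foldl (\<odot>) null gs = null" for gs by (induction gs) auto
    have "g \<odot> g \<in> sem_st x \<otimes> sem_st x" using g by (auto simp: smult_def)
    \<comment> \<open>If the square of \<open>g\<close> is \<open>null\<close>, it passes no test,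
      since \<open>null\<close> is absorbing and outside the pole; membership in the closure is then
      vacuous. Otherwise \<open>g\<close> is the unit.\<close>
    moreover have "g \<in> cl {g \<odot> g}"
      using mult_self[of g] * null_pole by (auto simp: cl_def)
    ultimately show "g \<in> cl (sem_st x \<otimes> sem_st x)"
      using cl_mono[of "{g \<odot> g}" "sem_st x \<otimes> sem_st x"] by auto
  qed
  then show ?case using sem_ctx_left[of _ "sem_st x \<otimes> sem_st x" u d] ruleC by simp
next
  case (ruleO x a)
  then show ?case using cl_empty_subset[of "Some a"] by simp
qed simp_all

end

section \<open>From derivations to accepting runs\<close>

text \<open>\<open>Part m c\<close> records the tokens and the tallies collected by a structure. Two parts without tokens
  merge to \<open>Null\<close>; hence every square is \<open>Null\<close> or the unit, which makes contraction sound.\<close>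

datatype conf = Null | Part "nat \<Rightarrow> tok option" "nat \<Rightarrow> nat"

definition void :: conf where
  "void = Part Map.empty (\<lambda>_. 0)"

text \<open>Not associative on purpose: a token takes up two tallies one after the other, but two
  tallies merged first give \<open>Null\<close>. Overlapping token positions also give
  \<open>Null\<close>.\<close>

fun merge :: "conf \<Rightarrow> conf \<Rightarrow> conf" where
  "merge (Part m c) (Part m' c') =
    (if Part m c = void then Part m' c' else if Part m' c' = void then Part m c
     else if dom m \<inter> dom m' = {} \<and> dom m \<union> dom m' \<noteq> {} then Part (m ++ m') (\<lambda>i. c i + c' i)
     else Null)"
| "merge _ _ = Null"

fun unerased :: "tok \<Rightarrow> tok" where
  "unerased IdleX = Idle"
| "unerased DoneX = Done"
| "unerased t = t"

abbreviation erased :: "tok set" where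
  "erased \<equiv> {IdleX, DoneX}"

lemma void_neq [simp]: "Part (m(j \<mapsto> t)) c \<noteq> void" "void \<noteq> Part (m(j \<mapsto> t)) c" "void \<noteq> Null" "Null \<noteq> void"
  by (auto simp: void_def fun_eq_iff split: if_splits)

lemma merge_simps [simp]: "merge void x = x" "merge x void = x" "merge Null x = Null" "merge x Null = Null"
  by (cases x; simp add: void_def)+

lemma merge_comm: "merge x y = merge y x"
proof (cases "x = Null \<or> y = Null \<or> x = void \<or> y = void")
  case False
  then obtain m c m' c' where [simp]: "x = Part m c" "y = Part m' c'"
    by (metis conf.exhaust)
  have nv: "Part m c \<noteq> void" "Part m' c' \<noteq> void" using False by auto
  show ?thesis
  proof (cases "dom m \<inter> dom m' = {} \<and> dom m \<union> dom m' \<noteq> {}")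
    case True
    then have "m ++ m' = m' ++ m" by (intro map_add_comm) simp
    moreover have "dom m' \<inter> dom m = {} \<and> dom m' \<union> dom m \<noteq> {}" using True by blast
    moreover have "(\<lambda>i. c i + c' i) = (\<lambda>i. c' i + c i)" by (rule ext) simp
    ultimately show ?thesis using True nv by (simp only: merge.simps \<open>x = _\<close> \<open>y = _\<close> if_False if_True)
  next
    case False
    then have "\<not> (dom m' \<inter> dom m = {} \<and> dom m' \<union> dom m \<noteq> {})" by blast
    with False show ?thesis using nv by (simp only: merge.simps \<open>x = _\<close> \<open>y = _\<close> if_False)
  qed
qed auto

definition layout :: "tok \<Rightarrow> (nat \<Rightarrow> tok) \<Rightarrow> nat list \<Rightarrow> nat \<Rightarrow> tok option" where
  "layout s g rs j = (case j of 0 \<Rightarrow> Some s | Suc i \<Rightarrow> if i \<in> set rs then Some (g i) else None)"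

lemma layout_simps [simp]:
  "layout s g rs 0 = Some s"
  "layout s g rs (Suc i) = (if i \<in> set rs then Some (g i) else None)"
  by (simp_all add: layout_def)

lemma layout_Nil: "layout s g [] = [0 \<mapsto> s]"
  by (auto simp: layout_def split: nat.splits)

lemma layout_Cons: "layout s g rs ++ [Suc r \<mapsto> g r] = layout s g (r # rs)"
  by (auto simp: layout_def map_add_def split: nat.splits)

lemma dom_layout: "dom (layout s g [0..<k]) = {..k}"
proof -
  have "j \<in> dom (layout s g [0..<k]) \<longleftrightarrow> j \<le> k" for j
    by (cases j) (auto split: if_splits)
  then show ?thesis by blast
qed

lemma merge_layout:
  assumes "r \<notin> set rs"
  shows "merge (Part (layout s g rs) c) (Part [Suc r \<mapsto> g r] c') = Part (layout s g (r # rs)) (\<lambda>i. c i + c' i)"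
proof -
  have "layout s g rs \<noteq> Map.empty" by (metis layout_simps(1) option.distinct(1))
  then have nv: "Part (layout s g rs) c \<noteq> void" by (auto simp: void_def)
  have "dom (layout s g rs) \<inter> dom [Suc r \<mapsto> g r] = {} \<and> dom (layout s g rs) \<union> dom [Suc r \<mapsto> g r] \<noteq> {}"
    using assms by auto
  then show ?thesis using nv by (simp only: merge.simps void_neq if_False if_True simp_thms layout_Cons)
qed

section \<open>Correct configurations and the pole\<close>

context
  fixes Prog :: "instr set" and k :: nat
begin

definition others_idle :: "(nat \<Rightarrow> tok) \<Rightarrow> nat \<Rightarrow> bool" where
  "others_idle ts i \<longleftrightarrow> (\<forall>j<k. j \<noteq> i \<longrightarrow> ts j = Idle)"

text \<open>In state \<open>Mid i q\<close> with all registers idle the register has already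
  answered, so only the run from the target \<open>q\<close> is still owed.\<close>

fun ok_idle :: "tok \<Rightarrow> (nat \<Rightarrow> nat) \<Rightarrow> bool" where
  "ok_idle (State q) c = acc Prog q c"
| "ok_idle (Mid i q) c = acc Prog q c"
| "ok_idle AskIdle c = True"
| "ok_idle _ c = False"

text \<open>The tally has already been removed, hence acceptance is required at the decremented
  values. In \<open>State q\<close> the target is not yet fixed, so some decrement instruction of
  \<open>q\<close> on \<open>i\<close> suffices.\<close>

fun ok_done :: "tok \<Rightarrow> nat \<Rightarrow> (nat \<Rightarrow> nat) \<Rightarrow> bool" where
  "ok_done (State q) i c = (\<exists>q'. Dec q i q' \<in> Prog \<and> acc Prog q' c)"
| "ok_done (Mid j q) i c = (i = j \<and> acc Prog q c)"
| "ok_done (AskDone j) i c = (i = j)"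
| "ok_done _ i c = False"

fun askable :: "tok \<Rightarrow> bool" where
  "askable (State q) = True"
| "askable (Mid i q) = True"
| "askable _ = False"

text \<open>The invariant of the simulation. At most one register is away from \<open>Idle\<close>,
  so handshakes never overlap.\<close>

definition ok :: "tok \<Rightarrow> (nat \<Rightarrow> tok) \<Rightarrow> (nat \<Rightarrow> nat) \<Rightarrow> bool" where
  "ok s ts c \<longleftrightarrow> (\<forall>j<k. ts j = Idle) \<and> ok_idle s c
    \<or> (\<exists>i<k. others_idle ts i \<and> (ts i = Done \<and> ok_done s i c \<or> ts i = Query s \<and> askable s))"

text \<open>An erased register stands for all values it may have had, whence the quantification over \<open>c'\<close>.\<close>

definition pole :: "conf set" where
  "pole = {Part m c |m c. dom m = {..k} \<and>
     (\<forall>c'. (\<forall>j. the (m (Suc j)) \<notin> erased \<longrightarrow> c' j = c j) \<longrightarrow>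
        ok (the (m 0)) (\<lambda>j. unerased (the (m (Suc j)))) c')}"

lemma ok_Idle: "i < k \<Longrightarrow> others_idle u i \<Longrightarrow> ok s (u(i := Idle)) c \<longleftrightarrow> ok_idle s c"
  unfolding ok_def others_idle_def by (auto split: if_splits)

lemma ok_Done: "i < k \<Longrightarrow> others_idle u i \<Longrightarrow> ok s (u(i := Done)) c \<longleftrightarrow> ok_done s i c"
  unfolding ok_def others_idle_def by (auto split: if_splits)

text \<open>What the check branch of a register rule contributes to its validity: it reveals the
  state and that the other registers are idle, independently of all values.\<close>

lemma ok_Query: "i < k \<Longrightarrow> ok s (u(i := Query s')) c \<longleftrightarrow> s = s' \<and> askable s \<and> others_idle u i"
  unfolding ok_def others_idle_def by (auto split: if_splits)

lemma ok_AskIdle: "ok AskIdle u c \<longleftrightarrow> (\<forall>j<k. u j = Idle)"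
  unfolding ok_def by auto

lemma ok_AskDone: "ok (AskDone i) u c \<longleftrightarrow> i < k \<and> others_idle u i \<and> u i = Done"
  unfolding ok_def by auto

lemma ok_all_idle: "(\<And>j. j < k \<Longrightarrow> u j = Idle) \<Longrightarrow> ok s u c \<longleftrightarrow> ok_idle s c"
  unfolding ok_def by auto

lemma ok_one_done: "others_idle u i \<Longrightarrow> i < k \<Longrightarrow> u i = Done \<Longrightarrow> ok s u c \<longleftrightarrow> ok_done s i c"
  using ok_Done[of i u s c] by (metis fun_upd_triv)

definition ok_reg :: "tok \<Rightarrow> (nat \<Rightarrow> tok) \<Rightarrow> nat \<Rightarrow> tok \<Rightarrow> (nat \<Rightarrow> nat) \<Rightarrow> bool" where
  "ok_reg s u i t c \<longleftrightarrow> (if t \<in> erased then \<forall>n. ok s (u(i := unerased t)) (c(i := n)) else ok s (u(i := t)) c)"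

lemma unerased_id: "t \<notin> erased \<Longrightarrow> unerased t = t"
  by (cases t) auto

lemma pole_state:
  "Part (m(0 \<mapsto> s)) c \<in> pole \<longleftrightarrow> insert 0 (dom m) = {..k} \<and>
     (\<forall>c'. (\<forall>j. the (m (Suc j)) \<notin> erased \<longrightarrow> c' j = c j) \<longrightarrow>
        ok s (\<lambda>j. unerased (the (m (Suc j)))) c')"
  unfolding pole_def by simp

text \<open>Separates register \<open>i\<close> from its surroundings, so that a register rule can
  be judged with state, other tokens and other values held fixed. Erasure of the register itself is
  accounted for in \<open>ok_reg\<close>.\<close>

lemma pole_reg:
  "Part (m(Suc i \<mapsto> t)) c \<in> pole \<longleftrightarrow> insert (Suc i) (dom m) = {..k} \<and>
     (\<forall>c'. (\<forall>j. j \<noteq> i \<longrightarrow> the (m (Suc j)) \<notin> erased \<longrightarrow> c' j = c j) \<longrightarrow>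
        ok_reg (the (m 0)) (\<lambda>j. unerased (the (m (Suc j)))) i t (c'(i := c i)))"
proof -
  let ?u = "\<lambda>j. unerased (the (m (Suc j)))"
  have u: "(\<lambda>j. unerased (the ((m(Suc i \<mapsto> t)) (Suc j)))) = ?u(i := unerased t)" by auto
  have "(\<forall>c'. (\<forall>j. the ((m(Suc i \<mapsto> t)) (Suc j)) \<notin> erased \<longrightarrow> c' j = c j) \<longrightarrow>
      ok (the (m 0)) (?u(i := unerased t)) c') \<longleftrightarrow>
    (\<forall>c'. (\<forall>j. j \<noteq> i \<longrightarrow> the (m (Suc j)) \<notin> erased \<longrightarrow> c' j = c j) \<longrightarrow>
      ok_reg (the (m 0)) ?u i t (c'(i := c i)))" (is "?l \<longleftrightarrow> ?r")
  proof (cases "t \<in> erased")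
    case True
    show ?thesis
    proof
      assume l: ?l
      show ?r
      proof (intro allI impI)
        fix c' assume "\<forall>j. j \<noteq> i \<longrightarrow> the (m (Suc j)) \<notin> erased \<longrightarrow> c' j = c j"
        then have "\<forall>j. the ((m(Suc i \<mapsto> t)) (Suc j)) \<notin> erased \<longrightarrow> (c'(i := n)) j = c j" for n
          using True by auto
        with l have "ok (the (m 0)) (?u(i := unerased t)) (c'(i := n))" for n by blast
        then show "ok_reg (the (m 0)) ?u i t (c'(i := c i))" using True by (simp add: ok_reg_def)
      qed
    next
      assume r: ?r
      show ?l
      proof (intro allI impI)
        fix c' assume "\<forall>j. the ((m(Suc i \<mapsto> t)) (Suc j)) \<notin> erased \<longrightarrow> c' j = c j"
        then have "\<forall>j. j \<noteq> i \<longrightarrow> the (m (Suc j)) \<notin> erased \<longrightarrow> c' j = c j" by auto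
        with r have "ok_reg (the (m 0)) ?u i t (c'(i := c i))" by blast
        then have "ok (the (m 0)) (?u(i := unerased t)) (c'(i := c' i))"
          using True unfolding ok_reg_def by (metis fun_upd_upd)
        then show "ok (the (m 0)) (?u(i := unerased t)) c'" by simp
      qed
    qed
  next
    case False
    show ?thesis
    proof
      assume l: ?l
      show ?r
      proof (intro allI impI)
        fix c' assume "\<forall>j. j \<noteq> i \<longrightarrow> the (m (Suc j)) \<notin> erased \<longrightarrow> c' j = c j"
        then have "\<forall>j. the ((m(Suc i \<mapsto> t)) (Suc j)) \<notin> erased \<longrightarrow> (c'(i := c i)) j = c j" by auto
        with l have "ok (the (m 0)) (?u(i := unerased t)) (c'(i := c i))" by blast
        then show "ok_reg (the (m 0)) ?u i t (c'(i := c i))"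
          using False unerased_id by (simp add: ok_reg_def)
      qed
    next
      assume r: ?r
      show ?l
      proof (intro allI impI)
        fix c' assume *: "\<forall>j. the ((m(Suc i \<mapsto> t)) (Suc j)) \<notin> erased \<longrightarrow> c' j = c j"
        then have "\<forall>j. j \<noteq> i \<longrightarrow> the (m (Suc j)) \<notin> erased \<longrightarrow> c' j = c j" by auto
        with r have "ok_reg (the (m 0)) ?u i t (c'(i := c i))" by blast
        moreover have "c'(i := c i) = c'" using * False by auto
        ultimately show "ok (the (m 0)) (?u(i := unerased t)) c'"
          using False unerased_id by (simp add: ok_reg_def)
      qed
    qed
  qed
  then show ?thesis unfolding pole_def using u by simp
qed

definition point :: "atom \<Rightarrow> conf" where
  "point a = (case a of Tally i \<Rightarrow> Part Map.empty ((\<lambda>_. 0)(i := 1))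
    | Tok j t \<Rightarrow> Part [j \<mapsto> t] (\<lambda>_. 0) | Goal \<Rightarrow> void)"

text \<open>With \<open>goal\<close> read as the pole, soundness of a derivation of
  \<open>goal\<close> says that the configuration lies in the pole. Every other atom is generated by
  a single point.\<close>

definition val :: "nat \<Rightarrow> conf set" where
  "val n = (if from_nat n = Goal then pole else {point (from_nat n)})"

interpretation phase_space merge void Null pole val
proof
  show "merge x y = merge y x" for x y by (rule merge_comm)
  show "Null \<notin> pole" by (auto simp: pole_def)
  show "merge x x = Null \<or> x = void" for x by (cases x) auto
qed auto

text \<open>Success of a merge with a token depends only on which positions are occupied, not on the
  token or on the tallies. Tests therefore treat all tokens at one position alike.\<close>

lemma merge_uniform:
  "(\<forall>t c. merge (Part (m(j \<mapsto> t)) c) g = Null) \<or>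
   (\<exists>m' d. \<forall>t c. merge (Part (m(j \<mapsto> t)) c) g = Part (m'(j \<mapsto> t)) (\<lambda>i. c i + d i))"
proof (cases g)
  case (Part mg cg)
  show ?thesis
  proof (cases "g = void")
    case True
    then show ?thesis by (intro disjI2 exI[of _ m] exI[of _ "\<lambda>_. 0"]) simp
  next
    case nv: False
    show ?thesis
    proof (cases "insert j (dom m) \<inter> dom mg = {}")
      case True
      then have "mg j = None" by auto
      then have "(m(j \<mapsto> t)) ++ mg = (m ++ mg)(j \<mapsto> t)" for t
        by (auto simp: map_add_def split: option.splits)
      then have "merge (Part (m(j \<mapsto> t)) c) g = Part ((m ++ mg)(j \<mapsto> t)) (\<lambda>i. c i + cg i)" for t c
        using True nv Part by simp
      then show ?thesis by blast
    next
      case False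
      then show ?thesis using nv Part by simp
    qed
  qed
qed simp

lemma foldl_merge_Null [simp]: "foldl merge Null gs = Null"
  by (induction gs) auto

lemma foldl_merge_uniform:
  "(\<forall>t c. foldl merge (Part (m(j \<mapsto> t)) c) gs = Null) \<or>
   (\<exists>m' d. \<forall>t c. foldl merge (Part (m(j \<mapsto> t)) c) gs = Part (m'(j \<mapsto> t)) (\<lambda>i. c i + d i))"
proof (induction gs arbitrary: m)
  case Nil
  show ?case by (intro disjI2 exI[of _ m] exI[of _ "\<lambda>_. 0"]) simp
next
  case (Cons g gs)
  from merge_uniform[of m j g] show ?case
  proof (elim disjE exE)
    assume "\<forall>t c. merge (Part (m(j \<mapsto> t)) c) g = Null"
    then show ?thesis by (simp del: fun_upd_apply)
  next
    fix m' d assume *: "\<forall>t c. merge (Part (m(j \<mapsto> t)) c) g = Part (m'(j \<mapsto> t)) (\<lambda>i. c i + d i)"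
    from Cons[of m'] show ?thesis
    proof (elim disjE exE)
      assume "\<forall>t c. foldl merge (Part (m'(j \<mapsto> t)) c) gs = Null"
      then show ?thesis using * by (simp del: fun_upd_apply)
    next
      fix m'' d' assume "\<forall>t c. foldl merge (Part (m'(j \<mapsto> t)) c) gs =
        Part (m''(j \<mapsto> t)) (\<lambda>i. c i + d' i)"
      then have "foldl merge (Part (m(j \<mapsto> t)) c) (g # gs) =
          Part (m''(j \<mapsto> t)) (\<lambda>i. c i + (d i + d' i))" for t c
        using * by (simp add: add.assoc del: fun_upd_apply)
      then show ?thesis by (intro disjI2 exI[of _ m''] exI[of _ "\<lambda>i. d i + d' i"] allI)
    qed
  qed
qed

text \<open>A test either kills every state token, and then no member of the nonempty
  \<open>T\<close> passes it, or completes all of them by the same surroundings. Closure membership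
  thus reduces to a statement about \<open>ok\<close>.\<close>

lemma cl_state:
  assumes "T \<noteq> {}" and "\<And>u c. (\<And>s'. s' \<in> T \<Longrightarrow> ok s' u c) \<Longrightarrow> ok s u c"
  shows "Part [0 \<mapsto> s] (\<lambda>_. 0) \<in> cl ((\<lambda>s. Part [0 \<mapsto> s] (\<lambda>_. 0)) ` T)"
  unfolding cl_def
proof (safe, goal_cases)
  case (1 gs)
  from foldl_merge_uniform[of Map.empty 0 gs] show ?case
  proof (elim disjE exE)
    assume "\<forall>t c. foldl merge (Part [0 \<mapsto> t] c) gs = Null"
    then show ?thesis using 1 assms(1) null_pole by force
  next
    fix m d assume "\<forall>t c. foldl merge (Part [0 \<mapsto> t] c) gs = Part (m(0 \<mapsto> t)) (\<lambda>i. c i + d i)"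
    then have *: "foldl merge (Part [0 \<mapsto> t] (\<lambda>_. 0)) gs = Part (m(0 \<mapsto> t)) d" for t by simp
    have T: "Part (m(0 \<mapsto> t)) d \<in> pole" if "t \<in> T" for t
      using 1 that * by force
    obtain t0 where t0: "t0 \<in> T" using assms(1) by blast
    show ?thesis unfolding * pole_state
    proof (intro conjI allI impI assms(2))
      show "insert 0 (dom m) = {..k}" using T[OF t0] unfolding pole_state by blast
    next
      fix c' s' assume "\<forall>j. the (m (Suc j)) \<notin> erased \<longrightarrow> c' j = d j" "s' \<in> T"
      then show "ok s' (\<lambda>j. unerased (the (m (Suc j)))) c'" using T[of s'] unfolding pole_state by blast
    qed
  qed
qed

abbreviation reg_point :: "nat \<Rightarrow> tok \<Rightarrow> nat \<Rightarrow> conf" where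
  "reg_point i t n \<equiv> Part [Suc i \<mapsto> t] ((\<lambda>_. 0)(i := n))"

text \<open>The analogue of \<open>cl_state\<close> for registers; \<open>a\<close> is the number of
  tallies that the surroundings add to register \<open>i\<close>.\<close>

lemma cl_reg:
  assumes "T \<noteq> {}" and "\<And>s u c a. \<lbrakk>i < k; \<And>t' n'. (t', n') \<in> T \<Longrightarrow> ok_reg s u i t' (c(i := a + n'))\<rbrakk>
    \<Longrightarrow> ok_reg s u i t (c(i := a + n))"
  shows "reg_point i t n \<in> cl ((\<lambda>(t, n). reg_point i t n) ` T)"
  unfolding cl_def
proof (safe, goal_cases)
  case (1 gs)
  from foldl_merge_uniform[of Map.empty "Suc i" gs] show ?case
  proof (elim disjE exE)
    assume "\<forall>t c. foldl merge (Part [Suc i \<mapsto> t] c) gs = Null"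
    then show ?thesis using 1 assms(1) null_pole by force
  next
    fix m d assume *: "\<forall>t c. foldl merge (Part [Suc i \<mapsto> t] c) gs = Part (m(Suc i \<mapsto> t)) (\<lambda>i. c i + d i)"
    have T: "Part (m(Suc i \<mapsto> t')) (\<lambda>j. ((\<lambda>_. 0)(i := n')) j + d j) \<in> pole" if "(t', n') \<in> T" for t' n'
      using 1 that * by force
    obtain t0 n0 where t0: "(t0, n0) \<in> T" using assms(1) by auto
    have dom: "insert (Suc i) (dom m) = {..k}" using T[OF t0] unfolding pole_reg by blast
    show ?thesis unfolding *[rule_format] pole_reg
    proof (intro conjI allI impI)
      show "insert (Suc i) (dom m) = {..k}" by (rule dom)
      fix c' assume c': "\<forall>j. j \<noteq> i \<longrightarrow> the (m (Suc j)) \<notin> erased \<longrightarrow>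
        c' j = ((\<lambda>_. 0)(i := n)) j + d j"
      have "ok_reg (the (m 0)) (\<lambda>j. unerased (the (m (Suc j)))) i t (c'(i := d i + n))"
      proof (rule assms(2))
        show "i < k" using dom by (metis Suc_le_lessD atMost_iff insertI1)
        fix t' n' assume t': "(t', n') \<in> T"
        have "\<forall>j. j \<noteq> i \<longrightarrow> the (m (Suc j)) \<notin> erased \<longrightarrow> c' j = ((\<lambda>_. 0)(i := n')) j + d j"
          using c' by simp
        then have "ok_reg (the (m 0)) (\<lambda>j. unerased (the (m (Suc j)))) i t'
            (c'(i := ((\<lambda>_. 0)(i := n')) i + d i))"
          using T[OF t'] unfolding pole_reg by blast
        then show "ok_reg (the (m 0)) (\<lambda>j. unerased (the (m (Suc j)))) i t' (c'(i := d i + n'))"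
          by (simp add: add.commute)
      qed
      then show "ok_reg (the (m 0)) (\<lambda>j. unerased (the (m (Suc j)))) i t
          (c'(i := ((\<lambda>_. 0)(i := n)) i + d i))"
        by (simp add: add.commute)
    qed
  qed
qed

lemma sem_goal: "sem goal = pole"
  by (simp add: atm_def val_def)

lemma sem_stt: "sem (stt s) = cl {Part [0 \<mapsto> s] (\<lambda>_. 0)}"
  by (simp add: atm_def val_def point_def)

lemma sem_rgt: "sem (rgt i t) = cl {reg_point i t 0}"
  by (simp add: atm_def val_def point_def fun_upd_idem)

lemma sem_tally: "sem (tally i) = cl {Part Map.empty ((\<lambda>_. 0)(i := 1))}"
  by (simp add: atm_def val_def point_def)

lemma sem_Prod: "sem a = cl {x} \<Longrightarrow> sem b = cl {y} \<Longrightarrow> sem (Prod a b) = cl {merge x y}"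
  by (simp add: cl_smult_cl) (simp add: smult_def)

lemma merge_tally:
  "merge (reg_point i t n) (Part Map.empty ((\<lambda>_. 0)(i := 1))) = reg_point i t (Suc n)"
proof -
  have "Part Map.empty ((\<lambda>_. 0)(i := 1)) \<noteq> void" by (auto simp: void_def fun_eq_iff)
  then show ?thesis by (auto simp: fun_eq_iff)
qed

lemma sem_Prod_tally: "sem (Prod (rgt i t) (tally i)) = cl {reg_point i t 1}"
  using sem_Prod[OF sem_rgt sem_tally] merge_tally[of i t 0] by simp

lemma sem_Join: "sem a = cl X \<Longrightarrow> sem b = cl Y \<Longrightarrow> sem (Join a b) = cl (X \<union> Y)"
proof -
  assume *: "sem a = cl X" "sem b = cl Y"
  have "cl X \<union> cl Y \<subseteq> cl (X \<union> Y)" using cl_mono[of X "X \<union> Y"] cl_mono[of Y "X \<union> Y"] by auto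
  then have "cl (cl X \<union> cl Y) \<subseteq> cl (X \<union> Y)" by (rule cl_least)
  moreover have "cl (X \<union> Y) \<subseteq> cl (cl X \<union> cl Y)"
    using cl_increasing[of X] cl_increasing[of Y] by (intro cl_mono) blast
  ultimately show ?thesis using * by simp
qed

text \<open>The unit lies in an implication iff the premise is included in the conclusion; as the
  latter is closed, a generator of the premise is enough.\<close>

lemma sem_rule:
  assumes "sem l = cl {x}" "x \<in> sem r"
  shows "void \<in> sem (Ldiv l r)"
proof -
  have "cl {x} \<subseteq> cl (sem r)" using assms(2) by (intro cl_mono) auto
  then show ?thesis using assms(1) by (auto simp: cl_sem)
qed

lemma sem_state_rule:
  assumes "sem r = cl ((\<lambda>s. Part [0 \<mapsto> s] (\<lambda>_. 0)) ` T)" "T \<noteq> {}"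
    and "\<And>u c. (\<And>s'. s' \<in> T \<Longrightarrow> ok s' u c) \<Longrightarrow> ok s u c"
  shows "void \<in> sem (Ldiv (stt s) r)"
  by (rule sem_rule[OF sem_stt]) (use cl_state[of T s] assms in auto)

lemma sem_reg_rule:
  assumes "sem l = cl {reg_point i t n}" "sem r = cl ((\<lambda>(t, n). reg_point i t n) ` T)" "T \<noteq> {}"
    and "\<And>s u c a. \<lbrakk>i < k; \<And>t' n'. (t', n') \<in> T \<Longrightarrow> ok_reg s u i t' (c(i := a + n'))\<rbrakk>
      \<Longrightarrow> ok_reg s u i t (c(i := a + n))"
  shows "void \<in> sem (Ldiv l r)"
  by (rule sem_rule[OF assms(1)]) (use cl_reg[of T i t n] assms in blast)

lemma sem_pattern:
  assumes "distinct rs"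
  shows "sem (pattern s g rs) = cl {Part (layout s g rs) (\<lambda>_. 0)}"
  using assms
proof (induction rs)
  case Nil
  then show ?case by (simp only: pattern.simps sem_stt layout_Nil)
next
  case (Cons r rs)
  have "merge (Part (layout s g rs) (\<lambda>_. 0)) (reg_point r (g r) 0) = Part (layout s g (r # rs)) (\<lambda>_. 0)"
    using Cons.prems by (subst merge_layout) auto
  moreover have "sem (pattern s g (r # rs)) = cl {merge (Part (layout s g rs) (\<lambda>_. 0)) (reg_point r (g r) 0)}"
    unfolding pattern.simps by (rule sem_Prod[OF _ sem_rgt]) (use Cons in simp)
  ultimately show ?case by simp
qed

text \<open>A pattern carries no tallies, so unerased registers have value 0, while erased ones
  stand for arbitrary values.\<close>

lemma sem_pattern_rule:
  assumes "\<And>c u. \<lbrakk>\<And>j. j < k \<Longrightarrow> u j = unerased (g j); \<And>j. \<lbrakk>j < k; g j \<notin> erased\<rbrakk> \<Longrightarrow> c j = 0\<rbrakk> \<Longrightarrow> ok s u c"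
  shows "void \<in> sem (Ldiv (pattern s g [0..<k]) goal)"
proof (rule sem_rule[OF sem_pattern])
  have "ok s (\<lambda>j. unerased (the (layout s g [0..<k] (Suc j)))) c'"
    if "\<forall>j. the (layout s g [0..<k] (Suc j)) \<notin> erased \<longrightarrow> c' j = 0" for c'
    by (rule assms) (use that in auto)
  then have "Part (layout s g [0..<k]) (\<lambda>_. 0) \<in> pole" unfolding pole_def by (auto simp: dom_layout)
  then show "Part (layout s g [0..<k]) (\<lambda>_. 0) \<in> sem goal" unfolding sem_goal .
qed simp

section \<open>Validity of the rewrite rules in the model\<close>

definition valid :: "fm \<times> fm \<Rightarrow> bool" where
  "valid p \<longleftrightarrow> void \<in> sem (Ldiv (fst p) (snd p))"

lemma valid_query_rules:
  assumes "i < k" "askable s" "p \<in> set (query_rules k i s)"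
  shows "valid p"
proof -
  have "valid (Prod (rgt i (Query s)) (tally i), rgt i (Query s))"
    unfolding valid_def fst_conv snd_conv
    by (rule sem_reg_rule[OF sem_Prod_tally, where T = "{(Query s, 0)}"])
      (auto simp: sem_rgt ok_reg_def ok_Query)
  moreover have "valid (pattern s ((\<lambda>_. IdleX)(i := Query s)) [0..<k], goal)"
    unfolding valid_def fst_conv snd_conv
  proof (rule sem_pattern_rule)
    fix c u assume u: "\<And>j. j < k \<Longrightarrow> u j = unerased (((\<lambda>_. IdleX)(i := Query s)) j)"
    then have "others_idle u i" "u i = Query s" using assms(1) by (auto simp: others_idle_def)
    then show "ok s u c" using ok_Query[OF assms(1), of s u s c] assms(2) by (metis fun_upd_triv)
  qed
  ultimately show ?thesis using assms(3) by auto
qed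

lemma valid_register_rules:
  assumes "i < k" "p \<in> set (register_rules k i)"
  shows "valid p"
proof -
  have "valid (rgt i Idle, rgt i IdleX)"
    unfolding valid_def fst_conv snd_conv
    by (rule sem_reg_rule[OF sem_rgt, where T = "{(IdleX, 0)}"]) (auto simp: sem_rgt ok_reg_def)
  moreover have "valid (rgt i Done, rgt i DoneX)"
    unfolding valid_def fst_conv snd_conv
    by (rule sem_reg_rule[OF sem_rgt, where T = "{(DoneX, 0)}"]) (auto simp: sem_rgt ok_reg_def)
  moreover have "valid (Prod (rgt i IdleX) (tally i), rgt i IdleX)"
    unfolding valid_def fst_conv snd_conv
    by (rule sem_reg_rule[OF sem_Prod_tally, where T = "{(IdleX, 0)}"]) (auto simp: sem_rgt ok_reg_def)
  moreover have "valid (Prod (rgt i DoneX) (tally i), rgt i DoneX)"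
    unfolding valid_def fst_conv snd_conv
    by (rule sem_reg_rule[OF sem_Prod_tally, where T = "{(DoneX, 0)}"]) (auto simp: sem_rgt ok_reg_def)
  moreover have "valid (pattern (AskDone i) ((\<lambda>_. IdleX)(i := DoneX)) [0..<k], goal)"
    unfolding valid_def fst_conv snd_conv
  proof (rule sem_pattern_rule)
    fix c u assume u: "\<And>j. j < k \<Longrightarrow> u j = unerased (((\<lambda>_. IdleX)(i := DoneX)) j)"
    then show "ok (AskDone i) u c" using assms(1) by (auto simp: ok_AskDone others_idle_def)
  qed
  ultimately show ?thesis using assms(2) by (auto simp: register_rules_def)
qed

lemma valid_Fork:
  assumes "Fork q q1 q2 \<in> Prog" "p \<in> set (instr_rules k (Fork q q1 q2))"
  shows "valid p"
proof -
  have "void \<in> sem (Ldiv (stt (State q)) (Join (stt (State q1)) (Join (stt (State q2)) (stt AskIdle))))"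
  proof (rule sem_state_rule)
    show "sem (Join (stt (State q1)) (Join (stt (State q2)) (stt AskIdle))) =
        cl ((\<lambda>s. Part [0 \<mapsto> s] (\<lambda>_. 0)) ` {State q1, State q2, AskIdle})"
      using sem_Join[OF sem_stt sem_Join[OF sem_stt sem_stt]] by (simp add: insert_commute)
    fix u c assume *: "\<And>s'. s' \<in> {State q1, State q2, AskIdle} \<Longrightarrow> ok s' u c"
    have idle: "\<And>j. j < k \<Longrightarrow> u j = Idle" using *[of AskIdle] by (simp add: ok_AskIdle)
    show "ok (State q) u c"
      using *[of "State q1"] *[of "State q2"] acc.fork[OF assms(1), of c] by (simp add: ok_all_idle idle)
  qed simp
  then show ?thesis using assms(2) by (simp add: valid_def)
qed

lemma valid_Havoc:
  assumes "Havoc q i \<in> Prog" "i < k" "p \<in> set (instr_rules k (Havoc q i))"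
  shows "valid p"
proof -
  \<comment> \<open>Acceptance in a state with a \<open>Havoc\<close> on \<open>i\<close> does not
    depend on register \<open>i\<close>; this makes adding and removing tallies there both
    valid.\<close>
  have havoc: "acc Prog q (c(i := n))" if "acc Prog q (c(i := m))" for c n m
    using acc.havoc[OF assms(1), of "c(i := n)" m] that by simp
  have "valid (rgt i Idle, Join (Prod (rgt i Idle) (tally i)) (rgt i (Query (State q))))"
    unfolding valid_def fst_conv snd_conv
  proof (rule sem_reg_rule[OF sem_rgt])
    show "sem (Join (Prod (rgt i Idle) (tally i)) (rgt i (Query (State q)))) =
        cl ((\<lambda>(t, n). reg_point i t n) ` {(Idle, 1), (Query (State q), 0)})"
      using sem_Join[OF sem_Prod_tally sem_rgt] by (simp add: insert_commute)
    fix s u c a assume *: "\<And>t' n'. (t', n') \<in> {(Idle, 1), (Query (State q), 0)} \<Longrightarrow>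
        ok_reg s u i t' (c(i := a + n'))"
    have "s = State q" "others_idle u i"
      using *[of "Query (State q)" 0] assms(2) by (simp_all add: ok_reg_def ok_Query)
    then show "ok_reg s u i Idle (c(i := a + 0))"
      using *[of Idle 1] assms(2) by (auto simp: ok_reg_def ok_Idle intro: havoc simp del: fun_upd_apply)
  qed simp
  moreover have "valid (Prod (rgt i Idle) (tally i), Join (rgt i Idle) (rgt i (Query (State q))))"
    unfolding valid_def fst_conv snd_conv
  proof (rule sem_reg_rule[OF sem_Prod_tally])
    show "sem (Join (rgt i Idle) (rgt i (Query (State q)))) =
        cl ((\<lambda>(t, n). reg_point i t n) ` {(Idle, 0), (Query (State q), 0)})"
      using sem_Join[OF sem_rgt sem_rgt] by (simp add: insert_commute)
    fix s u c a assume *: "\<And>t' n'. (t', n') \<in> {(Idle, 0), (Query (State q), 0)} \<Longrightarrow>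
        ok_reg s u i t' (c(i := a + n'))"
    have "s = State q" "others_idle u i"
      using *[of "Query (State q)" 0] assms(2) by (simp_all add: ok_reg_def ok_Query)
    then show "ok_reg s u i Idle (c(i := a + 1))"
      using *[of Idle 0] assms(2) by (auto simp: ok_reg_def ok_Idle intro: havoc simp del: fun_upd_apply)
  qed simp
  ultimately show ?thesis using assms(3) valid_query_rules[OF assms(2), of "State q"] by auto
qed

lemma valid_Dec:
  assumes "Dec q i q' \<in> Prog" "i < k" "p \<in> set (instr_rules k (Dec q i q'))"
  shows "valid p"
proof -
  have "valid (Prod (rgt i Idle) (tally i), Join (rgt i Done) (rgt i (Query (State q))))"
    unfolding valid_def fst_conv snd_conv
  proof (rule sem_reg_rule[OF sem_Prod_tally])
    show "sem (Join (rgt i Done) (rgt i (Query (State q)))) =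
        cl ((\<lambda>(t, n). reg_point i t n) ` {(Done, 0), (Query (State q), 0)})"
      using sem_Join[OF sem_rgt sem_rgt] by (simp add: insert_commute)
    fix s u c a assume *: "\<And>t' n'. (t', n') \<in> {(Done, 0), (Query (State q), 0)} \<Longrightarrow>
        ok_reg s u i t' (c(i := a + n'))"
    have s: "s = State q" "others_idle u i"
      using *[of "Query (State q)" 0] assms(2) by (simp_all add: ok_reg_def ok_Query)
    then have "ok_done (State q) i (c(i := a))"
      using *[of Done 0] assms(2) by (simp add: ok_reg_def ok_Done del: fun_upd_apply)
    \<comment> \<open>\<open>q''\<close> may differ from \<open>q'\<close>: the register does not
      know which decrement the state will choose, and acceptance needs only one of them.\<close>
    then obtain q'' where "Dec q i q'' \<in> Prog" "acc Prog q'' (c(i := a))" by auto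
    then have "acc Prog q (c(i := a + 1))" using acc.dec[of q i q'' Prog "c(i := a + 1)" a] by simp
    then show "ok_reg s u i Idle (c(i := a + 1))"
      using s assms(2) by (simp add: ok_reg_def ok_Idle del: fun_upd_apply)
  qed simp
  moreover have "valid (stt (State q), Join (stt (Mid i q')) (stt (AskDone i)))"
    unfolding valid_def fst_conv snd_conv
  proof (rule sem_state_rule)
    show "sem (Join (stt (Mid i q')) (stt (AskDone i))) =
        cl ((\<lambda>s. Part [0 \<mapsto> s] (\<lambda>_. 0)) ` {Mid i q', AskDone i})"
      using sem_Join[OF sem_stt sem_stt] by (simp add: insert_commute)
    fix u c assume *: "\<And>s'. s' \<in> {Mid i q', AskDone i} \<Longrightarrow> ok s' u c"
    have u: "others_idle u i" "i < k" "u i = Done" using *[of "AskDone i"] by (simp_all add: ok_AskDone)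
    show "ok (State q) u c"
      using *[of "Mid i q'"] assms(1) by (auto simp: ok_one_done[OF u])
  qed simp
  moreover have "valid (rgt i Done, Join (rgt i Idle) (rgt i (Query (Mid i q'))))"
    unfolding valid_def fst_conv snd_conv
  proof (rule sem_reg_rule[OF sem_rgt])
    show "sem (Join (rgt i Idle) (rgt i (Query (Mid i q')))) =
        cl ((\<lambda>(t, n). reg_point i t n) ` {(Idle, 0), (Query (Mid i q'), 0)})"
      using sem_Join[OF sem_rgt sem_rgt] by (simp add: insert_commute)
    fix s u c a assume *: "\<And>t' n'. (t', n') \<in> {(Idle, 0), (Query (Mid i q'), 0)} \<Longrightarrow>
        ok_reg s u i t' (c(i := a + n'))"
    have s: "s = Mid i q'" "others_idle u i"
      using *[of "Query (Mid i q')" 0] assms(2) by (simp_all add: ok_reg_def ok_Query)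
    then show "ok_reg s u i Done (c(i := a + 0))"
      using *[of Idle 0] assms(2) by (simp add: ok_reg_def ok_Idle ok_Done del: fun_upd_apply)
  qed simp
  moreover have "valid (stt (Mid i q'), Join (stt (State q')) (stt AskIdle))"
    unfolding valid_def fst_conv snd_conv
  proof (rule sem_state_rule)
    show "sem (Join (stt (State q')) (stt AskIdle)) =
        cl ((\<lambda>s. Part [0 \<mapsto> s] (\<lambda>_. 0)) ` {State q', AskIdle})"
      using sem_Join[OF sem_stt sem_stt] by (simp add: insert_commute)
    fix u c assume *: "\<And>s'. s' \<in> {State q', AskIdle} \<Longrightarrow> ok s' u c"
    have idle: "\<And>j. j < k \<Longrightarrow> u j = Idle" using *[of AskIdle] by (simp add: ok_AskIdle)
    show "ok (Mid i q') u c" using *[of "State q'"] by (simp add: ok_all_idle idle)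
  qed simp
  ultimately show ?thesis
    using assms(3) valid_query_rules[OF assms(2), of "State q"] valid_query_rules[OF assms(2), of "Mid i q'"]
    by auto
qed

lemma valid_Zero:
  assumes "Zero q i \<in> Prog" "i < k" "p \<in> set (instr_rules k (Zero q i))"
  shows "valid p"
proof -
  have "valid (pattern (State q) ((\<lambda>_. IdleX)(i := Idle)) [0..<k], goal)"
    unfolding valid_def fst_conv snd_conv
  proof (rule sem_pattern_rule)
    fix c u assume u: "\<And>j. j < k \<Longrightarrow> u j = unerased (((\<lambda>_. IdleX)(i := Idle)) j)"
      and c: "\<And>j. \<lbrakk>j < k; ((\<lambda>_. IdleX)(i := Idle)) j \<notin> erased\<rbrakk> \<Longrightarrow> c j = (0 :: nat)"
    have "acc Prog q c" by (rule acc.zero[OF assms(1)]) (use c[of i] assms(2) in simp)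
    then show "ok (State q) u c" using u by (subst ok_all_idle) auto
  qed
  then show ?thesis using assms(3) by simp
qed

lemma valid_rules:
  assumes "set Is = Prog"
    and "\<And>q i. Havoc q i \<in> Prog \<Longrightarrow> i < k" "\<And>q i q'. Dec q i q' \<in> Prog \<Longrightarrow> i < k"
      "\<And>q i. Zero q i \<in> Prog \<Longrightarrow> i < k"
    and "p \<in> set (rules k Is)"
  shows "valid p"
proof -
  have "valid p" if "I \<in> Prog" "p \<in> set (instr_rules k I)" for I
    using that assms(2-4) by (cases I) (metis valid_Fork valid_Havoc valid_Dec valid_Zero)+
  moreover have "valid (pattern AskIdle (\<lambda>_. IdleX) [0..<k], goal)"
    unfolding valid_def fst_conv snd_conv
    by (rule sem_pattern_rule) (simp add: ok_AskIdle)
  ultimately show ?thesis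
    using assms(1,5) valid_register_rules[of _ p] by (auto simp: rules_def)
qed

lemma void_in_bang_rules:
  assumes "\<And>p. p \<in> set Rs \<Longrightarrow> valid p"
  shows "void \<in> sem (bang_rules Rs)"
proof -
  have "void \<in> sem (Meets (map (\<lambda>(l, r). Ldiv l r) Rs))"
    using assms
  proof (induction Rs)
    case Nil
    then show ?case using cl_increasing[of "{void}"] by simp
  next
    case (Cons p Rs)
    then show ?case by (cases p) (auto simp: valid_def simp del: sem.simps(5))
  qed
  then show ?thesis using cl_increasing[of "{void}"] by (simp add: bang_rules_def)
qed

lemma reg_point_in_reg: "reg_point i t n \<in> sem_st (reg i t n)"
proof (induction n)
  case 0
  then show ?case using cl_increasing[of "{reg_point i t 0}"] by (simp only: reg.simps sem_st.simps sem_rgt) blast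
next
  case (Suc n)
  have "Part Map.empty ((\<lambda>_. 0)(i := 1)) \<in> sem (tally i)" using cl_increasing by (auto simp: sem_tally)
  then have "merge (reg_point i t n) (Part Map.empty ((\<lambda>_. 0)(i := 1))) \<in> sem_st (reg i t (Suc n))"
    unfolding reg.simps sem_st.simps using Suc by (intro smultI)
  then show ?case unfolding merge_tally .
qed

lemma layout_in_cfg:
  assumes "distinct rs"
  shows "Part (layout s (\<lambda>i. fst (f i)) rs) (\<lambda>i. if i \<in> set rs then snd (f i) else 0) \<in> sem_st (cfg s f rs)"
  using assms
proof (induction rs)
  case Nil
  then show ?case using cl_increasing[of "{Part [0 \<mapsto> s] (\<lambda>_. 0)}"] by (simp add: sem_stt layout_Nil del: fun_upd_apply)
next
  case (Cons r rs)
  let ?c = "\<lambda>rs i. if i \<in> set rs then snd (f i) else 0" and ?m = "layout s (\<lambda>i. fst (f i))"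
  have "(\<lambda>i. ?c rs i + ((\<lambda>_. 0)(r := snd (f r))) i) = ?c (r # rs)"
    using Cons.prems by auto
  then have "merge (Part (?m rs) (?c rs)) (reg_point r (fst (f r)) (snd (f r))) =
      Part (?m (r # rs)) (?c (r # rs))"
    using Cons.prems merge_layout[of r rs s "\<lambda>i. fst (f i)"] by simp
  moreover have "merge (Part (?m rs) (?c rs)) (reg_point r (fst (f r)) (snd (f r))) \<in> sem_st (cfg s f (r # rs))"
    unfolding cfg.simps sem_st.simps using Cons by (intro smultI reg_point_in_reg) simp
  ultimately show ?case by simp
qed

text \<open>The banged rules contain the unit, so the point of the bare configuration belongs to the
  interpretation of the whole antecedent and, by soundness, to the pole. That point carries 0
  outside the first \<open>k\<close> registers, as \<open>v\<close> must too.\<close>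

lemma acc_if_prov:
  assumes "set Is = Prog" "0 < k"
    and "\<And>q i. Havoc q i \<in> Prog \<Longrightarrow> i < k" "\<And>q i q'. Dec q i q' \<in> Prog \<Longrightarrow> i < k"
      "\<And>q i. Zero q i \<in> Prog \<Longrightarrow> i < k"
    and prov: "prov R (SC (SC (SF (bang_rules (rules k Is))) (cfg (State q) (\<lambda>i. (Idle, v i)) [1..<k]))
      (reg 0 Idle (v 0))) (Some goal)"
    and v: "\<And>i. k \<le> i \<Longrightarrow> v i = 0"
  shows "acc Prog q v"
proof -
  let ?m = "layout (State q) (\<lambda>_. Idle) [0..<k]"
  let ?B = "SF (bang_rules (rules k Is))" and ?f = "\<lambda>i. (Idle, v i)"
  let ?C = "sem_st (cfg (State q) ?f [1..<k])"
  have upt: "[0..<k] = 0 # [1..<k]" using assms(2) by (simp add: upt_conv_Cons)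
  have c: "(\<lambda>i. if i \<in> set [0..<k] then snd (?f i) else 0) = v" using v by auto
  have "Part ?m v \<in> sem_st (cfg (State q) ?f [0..<k])"
    using layout_in_cfg[of "[0..<k]" "State q" ?f] unfolding c by simp
  also have "\<dots> = smult ?C (sem_st (reg 0 Idle (v 0)))"
    unfolding upt by simp
  also have "\<dots> \<subseteq> smult (smult (sem_st ?B) ?C) (sem_st (reg 0 Idle (v 0)))"
  proof (rule smult_mono)
    have "void \<in> sem_st ?B"
      using void_in_bang_rules[of "rules k Is"] valid_rules[OF assms(1,3-5)] by simp
    then have "smult {void} ?C \<subseteq> smult (sem_st ?B) ?C"
      by (intro smult_mono) auto
    then show "?C \<subseteq> smult (sem_st ?B) ?C"
      by simp
  qed simp
  also have "\<dots> \<subseteq> sem_stoup (Some goal)" using soundness[OF prov] by simp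
  finally have "Part ?m v \<in> pole" by (simp add: sem_goal)
  then have "ok (State q) (\<lambda>j. unerased (the (?m (Suc j)))) v"
    unfolding pole_def by auto
  then show ?thesis by (subst (asm) ok_all_idle) auto
qed

end

section \<open>Undecidability\<close>

lemma cfg_cong: "(\<And>i. i \<in> set rs \<Longrightarrow> f i = g i) \<Longrightarrow> cfg s f rs = cfg s g rs"
  by (induction rs) auto

lemma enc_reg:
  "enc_st (reg i t n) =
    ((\<lambda>e. prod_encode (2, prod_encode (e, enc_st (SF (tally i))))) ^^ n) (enc_st (SF (rgt i t)))"
  by (induction n) auto

text \<open>Everything except register 0. Its code is independent of the input, and the full
  antecedent arises by one further composition.\<close>

definition program_st :: "nat \<Rightarrow> instr list \<Rightarrow> st" where
  "program_st k Is =
    SC (SF (bang_rules (rules k Is))) (cfg (State 0) (\<lambda>_. (Idle, 0)) [1..<k])"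

fun register_of :: "instr \<Rightarrow> nat" where
  "register_of (Fork _ _ _) = 0"
| "register_of (Havoc _ i) = i"
| "register_of (Dec _ i _) = i"
| "register_of (Zero _ i) = i"

text \<open>The simulation works in every rule set and the model validates every rule set, so
  provability of these sequents is the same for all \<open>R\<close>.\<close>

lemma prov_program_iff:
  assumes "0 < k" "\<And>I. I \<in> set Is \<Longrightarrow> register_of I < k"
  shows "prov R (SC (program_st k Is) (reg 0 Idle n)) (Some goal) \<longleftrightarrow>
    acc (set Is) 0 ((\<lambda>_. 0)(0 := n))"
proof
  let ?v = "(\<lambda>_. 0)(0 := n)" and ?B = "SF (bang_rules (rules k Is))"
  have cfg: "cfg (State 0) (\<lambda>_. (Idle, 0)) [1..<k] = cfg (State 0) (\<lambda>i. (Idle, ?v i)) [1..<k]"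
    by (rule cfg_cong) auto
  have regs: "\<And>q i. Havoc q i \<in> set Is \<Longrightarrow> i < k" "\<And>q i q'. Dec q i q' \<in> set Is \<Longrightarrow> i < k"
    "\<And>q i. Zero q i \<in> set Is \<Longrightarrow> i < k"
    using assms(2) by force+
  {
    assume "prov R (SC (program_st k Is) (reg 0 Idle n)) (Some goal)"
    then show "acc (set Is) 0 ?v"
      using acc_if_prov[OF refl assms(1) regs, where R = R and q = 0 and v = ?v] assms(1)
      unfolding program_st_def cfg by simp
  }
  assume "acc (set Is) 0 ?v"
  from derivable_if_acc[OF this regs(1,2), where R = R]
  have "derivable R (rules k Is) (cfg (State 0) (\<lambda>i. (Idle, ?v i)) (0 # [1..<k]))"
    using assms(1) by (simp add: upt_conv_Cons)
  then have "prov R (fill Hole (comp ?B (comp (cfg (State 0) (\<lambda>i. (Idle, ?v i)) [1..<k]) (reg 0 Idle n))))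
      (Some goal)"
    by (simp add: derivable_def comp_nonempty)
  \<comment> \<open>Rebracketing by \<open>ka1b\<close> splits off register 0, so that the
    input-free part becomes a subtree.\<close>
  then have "prov R (fill Hole (comp (comp ?B (cfg (State 0) (\<lambda>i. (Idle, ?v i)) [1..<k])) (reg 0 Idle n)))
      (Some goal)"
    by (intro prov.ka1b is_k_bang_rules) simp_all
  then show "prov R (SC (program_st k Is) (reg 0 Idle n)) (Some goal)"
    unfolding program_st_def cfg by (simp add: comp_nonempty)
qed

theorem mainTheorem3:
  fixes R :: "srule set"
  assumes "R \<subseteq> {RuleE, RuleC, RuleO}"
  shows "\<not> (\<exists>f. recfn 1 f \<and>
            (\<forall>x d. wf_st x \<longrightarrow> f [enc_seq x d] = (if prov R x d then 1 else 0)))"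
proof
  assume "\<exists>f. recfn 1 f \<and> (\<forall>x d. wf_st x \<longrightarrow> f [enc_seq x d] = (if prov R x d then 1 else 0))"
  then obtain f where f: "recfn 1 f"
    and decides: "\<And>x d. wf_st x \<Longrightarrow> f [enc_seq x d] = (if prov R x d then 1 else 0)" by blast
  \<comment> \<open>\<open>e\<close> occurs twice, as the code of the input-free part and as the
    input. The tag \<open>2\<close> is that of \<open>SC\<close>, and \<open>Suc\<close> marks a
    nonempty stoup.\<close>
  define diag where "diag e = prod_encode (prod_encode (2, prod_encode (e, enc_st (reg 0 Idle e))),
    Suc (enc_fm goal))" for e
  have "computable 1 (\<lambda>xs. enc_st (reg 0 Idle (xs ! 0)))"
    unfolding enc_reg
    by (intro computable_iterate computable_prod_encode computable_const computable_proj) simp_all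
  then have "computable 1 (\<lambda>xs. diag (xs ! 0))"
    unfolding diag_def by (intro computable_prod_encode computable_const computable_proj) simp_all
  moreover have "computable 1 f" using f by (rule computableI) simp
  ultimately have "computable 1 (\<lambda>xs. f [diag (xs ! 0)])" by (intro computable_compose1)
  then obtain g where g: "recfn 1 g" "\<And>e. g [e] = f [diag e]" unfolding computable_def by force
  obtain P where P: "finite P" "\<And>v. acc P 0 v \<longleftrightarrow> g [v 0] = 0" by (rule recfn_zero_program[OF g(1)]) (rule that)
  obtain Is where Is: "set Is = P" using finite_list[OF P(1)] by blast
  \<comment> \<open>Including 0 guarantees \<open>0 < k\<close>, so the input register is present;
    it also covers the value that \<open>register_of\<close> assigns to forks.\<close>
  have "finite (insert 0 (register_of ` P))" using P(1) by simp
  then obtain k where k: "\<And>i. i \<in> insert 0 (register_of ` P) \<Longrightarrow> i < k"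
    by (metis finite_nat_set_iff_bounded)
  define e where "e = enc_st (program_st k Is)"
  let ?x = "SC (program_st k Is) (reg 0 Idle e)"
  have wf: "wf_st ?x" by (simp add: program_st_def bang_rules_def)
  have "prov R ?x (Some goal) \<longleftrightarrow> acc P 0 ((\<lambda>_. 0)(0 := e))"
    unfolding Is[symmetric] by (rule prov_program_iff) (use k Is in auto)
  \<comment> \<open>The program accepts its own code iff \<open>f\<close> answers 0, that is
    unprovable, on the sequent that expresses this very acceptance.\<close>
  also have "\<dots> \<longleftrightarrow> f [diag e] = 0" by (simp add: P(2) g(2))
  also have "diag e = enc_seq ?x (Some goal)" by (simp add: diag_def e_def enc_seq_def)
  finally show False using decides[OF wf, of "Some goal"] by (simp split: if_splits)
qed

end
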